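(* No duality of a thick generalised $2n$-gon is anisotropic. Moreover, if $\Gamma$ is a finite thick generalised $2n$-gon with parameters $(s,t)$ then: (1) If $n=2$ then anisotropic collineations of $\Gamma$ can only exist if $s$ and $t$ are coprime. (2) If $n=3$ then anisotropic collineations of $\Gamma$ do not exist. Moreover, if a collineation $\theta$ of $\Gamma$ satisfies $d(L,L^\theta)\in\{4,6\}$ for all lines $L$ (or $d(p,p^\theta)\in\{4,6\}$ for all points $p$), then $s$ and $t$ are coprime. (3) If $n=4$ then anisotropic collineations of $\Gamma$ do not exist. Moreover, no collineation $\theta$ of $\Gamma$ satisfies $d(L,L^\theta)\in\{6,8\}$ for all lines $L$ (or $d(p,p^\theta)\in\{6,8\}$ for all points $p$), and if a collineation $\theta$ of $\Gamma$ satisfies $d(L,L^\theta)\in\{4,6,8\}$ for all lines $L$ (or $d(p,p^\theta)\in\{4,6,8\}$ for all points $p$), then $s$ and $t$ are coprime.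
   Context: A generalised $k$-gon ($k\geq 2$) is a nonempty point-line geometry $\Gamma=(\mathcal{P},\mathcal{L},\mathbf{I})$ containing no ordinary $j$-gon (as a subgeometry) for $2\leq j<k$ and such that any two elements of $\mathcal{P}\cup\mathcal{L}$ are contained in some ordinary $k$-gon in $\Gamma$. It is thick if each point is on at least $3$ lines and each line contains at least $3$ points. It has parameters $(s,t)$ if each line contains exactly $s+1$ points and each point is on exactly $t+1$ lines. Let $d(x,y)$ be the distance in the incidence graph (vertex set $\mathcal{P}\cup\mathcal{L}$, edges the incident pairs). An automorphism is a bijection of $\mathcal{P}\cup\mathcal{L}$ preserving incidence and non-incidence, which either preserves $\mathcal{P}$ and $\mathcal{L}$ (collineation) or interchanges them (duality). In a generalised $2n$-gon two elements are opposite if they are at distance $2n$. A chamber is an incident point-line pair; chambers $\{p,L\}$ and $\{p',L'\}$ of a generalised $2n$-gon are opposite if $p,p'$ are opposite and $L,L'$ are opposite. An automorphism is anisotropic if it maps every chamber to an opposite chamber. *)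

theory Defs
  imports Main
begin

record 'a geometry =
  Points :: "'a set"
  Lines :: "'a set"
  Inc :: "('a \<times> 'a) set"

definition Elements :: "'a geometry \<Rightarrow> 'a set" where
  "Elements \<Gamma> = Points \<Gamma> \<union> Lines \<Gamma>"

definition point_line_geometry :: "'a geometry \<Rightarrow> bool" where
  "point_line_geometry \<Gamma> \<longleftrightarrow>
     Points \<Gamma> \<inter> Lines \<Gamma> = {} \<and> Inc \<Gamma> \<subseteq> Points \<Gamma> \<times> Lines \<Gamma>"

text \<open>Subgeometries carry the induced incidence.  For the definition of a generalised polygon
  this is no restriction: a shortest cycle of the incidence graph has no chords.\<close>

definition subgeometry :: "'a geometry \<Rightarrow> 'a geometry \<Rightarrow> bool" where
  "subgeometry \<Delta> \<Gamma> \<longleftrightarrow>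
     Points \<Delta> \<subseteq> Points \<Gamma> \<and> Lines \<Delta> \<subseteq> Lines \<Gamma> \<and>
     Inc \<Delta> = Inc \<Gamma> \<inter> (Points \<Delta> \<times> Lines \<Delta>)"

definition ordinary_polygon :: "nat \<Rightarrow> 'a geometry \<Rightarrow> bool" where
  "ordinary_polygon k \<Delta> \<longleftrightarrow> k \<ge> 2 \<and> point_line_geometry \<Delta> \<and>
     (\<exists>p l. bij_betw p {..<k} (Points \<Delta>) \<and> bij_betw l {..<k} (Lines \<Delta>) \<and>
        Inc \<Delta> = (\<Union>i<k. {(p i, l i), (p (Suc i mod k), l i)}))"

definition generalised_polygon :: "nat \<Rightarrow> 'a geometry \<Rightarrow> bool" where
  "generalised_polygon k \<Gamma> \<longleftrightarrow> k \<ge> 2 \<and> point_line_geometry \<Gamma> \<and> Elements \<Gamma> \<noteq> {} \<and>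
     (\<forall>j. 2 \<le> j \<and> j < k \<longrightarrow> \<not> (\<exists>\<Delta>. ordinary_polygon j \<Delta> \<and> subgeometry \<Delta> \<Gamma>)) \<and>
     (\<forall>x\<in>Elements \<Gamma>. \<forall>y\<in>Elements \<Gamma>.
        \<exists>\<Delta>. ordinary_polygon k \<Delta> \<and> subgeometry \<Delta> \<Gamma> \<and> x \<in> Elements \<Delta> \<and> y \<in> Elements \<Delta>)"

definition lines_on :: "'a geometry \<Rightarrow> 'a \<Rightarrow> 'a set" where
  "lines_on \<Gamma> p = {L. (p, L) \<in> Inc \<Gamma>}"

definition points_on :: "'a geometry \<Rightarrow> 'a \<Rightarrow> 'a set" where
  "points_on \<Gamma> L = {p. (p, L) \<in> Inc \<Gamma>}"

text \<open>Infinite point rows and line pencils are allowed, but \<^const>\<open>card\<close> is \<open>0\<close> on them.\<close>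

definition thick :: "'a geometry \<Rightarrow> bool" where
  "thick \<Gamma> \<longleftrightarrow>
     (\<forall>p\<in>Points \<Gamma>. infinite (lines_on \<Gamma> p) \<or> card (lines_on \<Gamma> p) \<ge> 3) \<and>
     (\<forall>L\<in>Lines \<Gamma>. infinite (points_on \<Gamma> L) \<or> card (points_on \<Gamma> L) \<ge> 3)"

definition has_parameters :: "'a geometry \<Rightarrow> nat \<Rightarrow> nat \<Rightarrow> bool" where
  "has_parameters \<Gamma> s t \<longleftrightarrow>
     (\<forall>L\<in>Lines \<Gamma>. card (points_on \<Gamma> L) = s + 1) \<and>
     (\<forall>p\<in>Points \<Gamma>. card (lines_on \<Gamma> p) = t + 1)"

definition adjacency :: "'a geometry \<Rightarrow> ('a \<times> 'a) set" where
  "adjacency \<Gamma> = Inc \<Gamma> \<union> (Inc \<Gamma>)\<inverse>"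

text \<open>Distance in the incidence graph.  It is meaningful only when \<open>x\<close> and \<open>y\<close> are connected,
  which always holds for elements of a generalised polygon.\<close>

definition inc_dist :: "'a geometry \<Rightarrow> 'a \<Rightarrow> 'a \<Rightarrow> nat" where
  "inc_dist \<Gamma> x y = (LEAST m. (x, y) \<in> adjacency \<Gamma> ^^ m)"

text \<open>Automorphisms are functions on the whole type; only their values on the elements of the
  geometry matter.\<close>

definition preserves_incidence :: "'a geometry \<Rightarrow> ('a \<Rightarrow> 'a) \<Rightarrow> bool" where
  "preserves_incidence \<Gamma> \<theta> \<longleftrightarrow> bij_betw \<theta> (Elements \<Gamma>) (Elements \<Gamma>) \<and>
     (\<forall>x\<in>Elements \<Gamma>. \<forall>y\<in>Elements \<Gamma>.
        (\<theta> x, \<theta> y) \<in> adjacency \<Gamma> \<longleftrightarrow> (x, y) \<in> adjacency \<Gamma>)"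

definition collineation :: "'a geometry \<Rightarrow> ('a \<Rightarrow> 'a) \<Rightarrow> bool" where
  "collineation \<Gamma> \<theta> \<longleftrightarrow> preserves_incidence \<Gamma> \<theta> \<and>
     \<theta> ` Points \<Gamma> = Points \<Gamma> \<and> \<theta> ` Lines \<Gamma> = Lines \<Gamma>"

definition duality :: "'a geometry \<Rightarrow> ('a \<Rightarrow> 'a) \<Rightarrow> bool" where
  "duality \<Gamma> \<theta> \<longleftrightarrow> preserves_incidence \<Gamma> \<theta> \<and>
     \<theta> ` Points \<Gamma> = Lines \<Gamma> \<and> \<theta> ` Lines \<Gamma> = Points \<Gamma>"

definition automorphism :: "'a geometry \<Rightarrow> ('a \<Rightarrow> 'a) \<Rightarrow> bool" where
  "automorphism \<Gamma> \<theta> \<longleftrightarrow> collineation \<Gamma> \<theta> \<or> duality \<Gamma> \<theta>"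

text \<open>In the next definitions \<open>\<Gamma>\<close> is meant to be a generalised \<open>2n\<close>-gon.\<close>

definition opposite :: "nat \<Rightarrow> 'a geometry \<Rightarrow> 'a \<Rightarrow> 'a \<Rightarrow> bool" where
  "opposite n \<Gamma> x y \<longleftrightarrow> x \<in> Elements \<Gamma> \<and> y \<in> Elements \<Gamma> \<and> inc_dist \<Gamma> x y = 2 * n"

definition chambers :: "'a geometry \<Rightarrow> 'a set set" where
  "chambers \<Gamma> = {{p, L} | p L. (p, L) \<in> Inc \<Gamma>}"

definition opposite_chambers :: "nat \<Rightarrow> 'a geometry \<Rightarrow> 'a set \<Rightarrow> 'a set \<Rightarrow> bool" where
  "opposite_chambers n \<Gamma> C C' \<longleftrightarrow>
     (\<exists>p L p' L'. (p, L) \<in> Inc \<Gamma> \<and> (p', L') \<in> Inc \<Gamma> \<and> C = {p, L} \<and> C' = {p', L'} \<and>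
        opposite n \<Gamma> p p' \<and> opposite n \<Gamma> L L')"

definition anisotropic :: "nat \<Rightarrow> 'a geometry \<Rightarrow> ('a \<Rightarrow> 'a) \<Rightarrow> bool" where
  "anisotropic n \<Gamma> \<theta> \<longleftrightarrow> automorphism \<Gamma> \<theta> \<and>
     (\<forall>C\<in>chambers \<Gamma>. opposite_chambers n \<Gamma> C (\<theta> ` C))"

end

theory Submission
  imports Defs "Jordan_Normal_Form.Schur_Decomposition" "HOL-Combinatorics.Cycles"
    "HOL-Computational_Algebra.Nth_Powers"
begin

text \<open>A duality \<open>\<theta>\<close> fails to be anisotropic at any point \<open>p\<close>: the distance from \<open>p\<close> to the line
  \<open>\<theta> p\<close> is odd, hence less than \<open>2n\<close>, and the first line of a shortest path from \<open>p\<close> to \<open>\<theta> p\<close> is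
  even closer to \<open>\<theta> p\<close>.

  For a collineation of a finite polygon let \<open>N\<close> be the point-line incidence matrix, \<open>M = N N\<^sup>T\<close>, and
  let \<open>E\<close> be the projection onto an eigenspace of \<open>M\<close>.  The entries of \<open>E\<close> depend only on the
  distance, so \<open>E\<close> commutes with the permutation matrix \<open>P\<close> of the collineation, and the trace of
  \<open>E P\<close> is a sum of roots of unity.  It is therefore an algebraic integer, and a natural number if
  \<open>P = 1\<close>.  Writing \<open>E\<close> as a combination of powers of \<open>M\<close> turns this into a divisibility
  condition on \<open>(s,t)\<close>, because the traces of \<open>M P\<close> and \<open>M\<^sup>2 P\<close> vanish if all displacements are
  large.  The case \<open>P = 1\<close> forces \<open>st\<close> (hexagons) or \<open>2st\<close> (octagons) to be a square.  For coprime
  \<open>s\<close>, \<open>t\<close> the remaining conditions reduce to \<open>a\<^sup>2 + b\<^sup>2 + 1 = mab\<close> and \<open>2a\<^sup>2 + b\<^sup>2 + 1 = 2mab\<close>,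
  where Vieta jumping gives \<open>m = 3\<close> and \<open>m = 2\<close>, and leave finitely many parameters to check.\<close>

section \<open>Distances in a generalised polygon\<close>

text \<open>The equivalence in the last hypothesis excludes chords, because subgeometries are
  induced. The circuit starts at a point, so even indices carry points and odd ones lines.\<close>

lemma ordinary_polygon_of_induced_cycle:
  fixes c :: "nat \<Rightarrow> 'a"
  assumes pl: "point_line_geometry \<Gamma>" and j: "j \<ge> 2"
    and inj: "inj_on c {..<2*j}"
    and P: "\<And>i. i < 2*j \<Longrightarrow> even i \<Longrightarrow> c i \<in> Points \<Gamma>"
    and L: "\<And>i. i < 2*j \<Longrightarrow> odd i \<Longrightarrow> c i \<in> Lines \<Gamma>"
    and adj: "\<And>i i'. i < 2*j \<Longrightarrow> i' < 2*j \<Longrightarrow>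
       (c i, c i') \<in> adjacency \<Gamma> \<longleftrightarrow> i' = Suc i mod (2*j) \<or> i = Suc i' mod (2*j)"
  shows "\<exists>\<Delta>. ordinary_polygon j \<Delta> \<and> subgeometry \<Delta> \<Gamma>"
proof -
  define p where "p = (\<lambda>i. c (2*i))"
  define l where "l = (\<lambda>i. c (2*i+1))"
  define \<Delta> where "\<Delta> = \<lparr>Points = p ` {..<j}, Lines = l ` {..<j}, Inc = Inc \<Gamma> \<inter> (p ` {..<j} \<times> l ` {..<j})\<rparr>"
  have pin: "p i \<in> Points \<Gamma>" if "i < j" for i using P that by (auto simp: p_def)
  have lin: "l i \<in> Lines \<Gamma>" if "i < j" for i using L that by (auto simp: l_def)
  have sub: "subgeometry \<Delta> \<Gamma>"
    using pin lin unfolding subgeometry_def \<Delta>_def by auto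
  have plg: "point_line_geometry \<Delta>"
    using pl sub unfolding point_line_geometry_def subgeometry_def by auto
  have bp: "bij_betw p {..<j} (Points \<Delta>)"
    unfolding bij_betw_def \<Delta>_def p_def
    by (auto intro!: inj_onI dest!: inj_onD[OF inj])
  have bl: "bij_betw l {..<j} (Lines \<Delta>)"
    unfolding bij_betw_def \<Delta>_def l_def
    by (auto intro!: inj_onI dest!: inj_onD[OF inj])
  \<comment> \<open>The step from a line to the next point may close the circuit; reduction modulo
    \<open>2 * j\<close> then becomes reduction modulo \<open>j\<close>.\<close>
  have md: "Suc (2 * b + 1) mod (2 * j) = 2 * (Suc b mod j)" for b
  proof -
    have "Suc (2 * b + 1) = 2 * Suc b" by simp
    thus ?thesis by (simp only: mult_mod_right)
  qed
  have inc: "(p a, l b) \<in> Inc \<Gamma> \<longleftrightarrow> a = b \<or> a = Suc b mod j" if "a < j" "b < j" for a b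
  proof -
    have "(p a, l b) \<in> Inc \<Gamma> \<longleftrightarrow> (p a, l b) \<in> adjacency \<Gamma>"
      using pl pin[OF that(1)] lin[OF that(2)]
      unfolding adjacency_def point_line_geometry_def by blast
    also have "\<dots> \<longleftrightarrow> 2*b+1 = Suc (2*a) mod (2*j) \<or> 2*a = Suc (2*b+1) mod (2*j)"
      unfolding p_def l_def using that by (intro adj) auto
    also have "\<dots> \<longleftrightarrow> a = b \<or> a = Suc b mod j"
      using that by (simp only: md) auto
    finally show ?thesis .
  qed
  have "Inc \<Delta> = (\<Union>i<j. {(p i, l i), (p (Suc i mod j), l i)})"
  proof (intro equalityI subsetI)
    fix z assume "z \<in> Inc \<Delta>"
    then obtain a b where "z = (p a, l b)" "a < j" "b < j" "(p a, l b) \<in> Inc \<Gamma>"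
      unfolding \<Delta>_def by auto
    thus "z \<in> (\<Union>i<j. {(p i, l i), (p (Suc i mod j), l i)})" using inc by auto
  next
    fix z assume "z \<in> (\<Union>i<j. {(p i, l i), (p (Suc i mod j), l i)})"
    then obtain i where "i < j" "z = (p i, l i) \<or> z = (p (Suc i mod j), l i)" by auto
    moreover have "Suc i mod j < j" using j by auto
    ultimately show "z \<in> Inc \<Delta>" using inc[of i i] inc[of "Suc i mod j" i] unfolding \<Delta>_def by auto
  qed
  thus ?thesis using sub plg bp bl j unfolding ordinary_polygon_def by blast
qed

section \<open>The incidence graph as a bipartite metric space\<close>

locale polygon =
  fixes \<Gamma> :: "'a geometry" and k :: nat
  assumes gp: "generalised_polygon k \<Gamma>"
begin

abbreviation "P \<equiv> Points \<Gamma>"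
abbreviation "L \<equiv> Lines \<Gamma>"
abbreviation "E \<equiv> Elements \<Gamma>"
abbreviation "A \<equiv> adjacency \<Gamma>"
abbreviation "d \<equiv> inc_dist \<Gamma>"

lemma plg: "point_line_geometry \<Gamma>" and k2: "k \<ge> 2" and nonempty: "E \<noteq> {}"
  using gp unfolding generalised_polygon_def by auto

lemma PL: "P \<inter> L = {}" "E = P \<union> L"
  using plg unfolding point_line_geometry_def Elements_def by auto

lemma A_sym: "(x, y) \<in> A \<Longrightarrow> (y, x) \<in> A"
  unfolding adjacency_def by auto

lemma A_P: "(x, y) \<in> A \<Longrightarrow> x \<in> P \<Longrightarrow> y \<in> L" "(x, y) \<in> A \<Longrightarrow> x \<in> L \<Longrightarrow> y \<in> P"
  and A_E: "(x, y) \<in> A \<Longrightarrow> x \<in> E" "(x, y) \<in> A \<Longrightarrow> y \<in> E"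
  using plg unfolding adjacency_def point_line_geometry_def Elements_def by auto

lemma relpow_sym: "(x, y) \<in> A ^^ m \<Longrightarrow> (y, x) \<in> A ^^ m"
proof (induction m arbitrary: y)
  case (Suc m)
  then obtain z where "(x, z) \<in> A ^^ m" "(z, y) \<in> A" by auto
  with Suc.IH show ?case using A_sym relpow_Suc_I2 by meson
qed auto

lemma relpow_parity:
  assumes "(x, y) \<in> A ^^ m" "x \<in> E"
  shows "y \<in> E \<and> ((x \<in> P \<longleftrightarrow> y \<in> P) \<longleftrightarrow> even m)"
  using assms
proof (induction m arbitrary: y)
  case (Suc m)
  then obtain z where z: "(x, z) \<in> A ^^ m" "(z, y) \<in> A" by auto
  with Suc.IH Suc.prems A_P[OF z(2)] A_E[OF z(2)] PL show ?case by auto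
qed auto

text \<open>Both elements lie on an ordinary \<open>k\<close>-gon, a circuit of length
  \<open>2 * k\<close>, and one of the two arcs between them has length at most
  \<open>k\<close>.\<close>

lemma connected:
  assumes "x \<in> E" "y \<in> E"
  shows "\<exists>m\<le>k. (x, y) \<in> A ^^ m"
proof -
  obtain \<Delta> where op: "ordinary_polygon k \<Delta>" and sub: "subgeometry \<Delta> \<Gamma>"
    and xy: "x \<in> Elements \<Delta>" "y \<in> Elements \<Delta>"
    using gp assms unfolding generalised_polygon_def by blast
  obtain p l where p: "bij_betw p {..<k} (Points \<Delta>)" and l: "bij_betw l {..<k} (Lines \<Delta>)"
    and Inc: "Inc \<Delta> = (\<Union>i<k. {(p i, l i), (p (Suc i mod k), l i)})"
    using op unfolding ordinary_polygon_def by blast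
  define c where "c i = (if even i then p ((i div 2) mod k) else l ((i div 2) mod k))" for i
  have step: "(c i, c (Suc i)) \<in> A" for i
  proof -
    have m: "(i div 2) mod k < k" using k2 by auto
    have "Inc \<Delta> \<subseteq> Inc \<Gamma>" using sub unfolding subgeometry_def by auto
    hence a: "(p ((i div 2) mod k), l ((i div 2) mod k)) \<in> A"
      "(l ((i div 2) mod k), p (Suc ((i div 2) mod k) mod k)) \<in> A"
      using m unfolding adjacency_def Inc by auto
    show ?thesis
    proof (cases "even i")
      case True
      hence "c i = p ((i div 2) mod k)" "c (Suc i) = l ((i div 2) mod k)" by (auto simp: c_def)
      thus ?thesis using a by simp
    next
      case False
      hence "Suc i div 2 = Suc (i div 2)" by (auto elim: oddE)
      hence "c i = l ((i div 2) mod k)" "c (Suc i) = p (Suc ((i div 2) mod k) mod k)"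
        using False by (auto simp: c_def mod_Suc_eq)
      thus ?thesis using a by simp
    qed
  qed
  have walk: "(c i, c (i + m)) \<in> A ^^ m" for i m
    by (induction m) (use step in \<open>auto intro: relcompI\<close>)
  have per: "c (i + 2 * k) = c i" for i
    by (auto simp: c_def)
  have ex: "\<exists>i<2*k. z = c i" if z: "z \<in> Elements \<Delta>" for z
  proof (cases "z \<in> Points \<Delta>")
    case True
    then obtain i where "i < k" "z = p i" using p unfolding bij_betw_def by auto
    thus ?thesis by (intro exI[of _ "2*i"]) (auto simp: c_def)
  next
    case False
    then obtain i where "i < k" "z = l i" using z l unfolding bij_betw_def Elements_def by auto
    thus ?thesis by (intro exI[of _ "2*i+1"]) (auto simp: c_def)
  qed
  have main: "\<exists>m\<le>k. (c i, c j) \<in> A ^^ m" if "i \<le> j" "j < 2*k" for i j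
  proof (cases "j - i \<le> k")
    case True
    thus ?thesis using walk[of i "j-i"] that by auto
  next
    case False
    \<comment> \<open>The complementary arc, from \<open>c j\<close> onwards to
      \<open>c (i + 2 * k) = c i\<close>.\<close>
    have "(c j, c (j + (i + 2*k - j))) \<in> A ^^ (i + 2*k - j)" by (rule walk)
    moreover have "j + (i + 2*k - j) = i + 2*k" using that by auto
    ultimately have "(c j, c i) \<in> A ^^ (i + 2*k - j)" by (simp add: per)
    hence "(c i, c j) \<in> A ^^ (i + 2*k - j)" by (rule relpow_sym)
    thus ?thesis using False by (intro exI[of _ "i + 2*k - j"]) auto
  qed
  obtain i j where ij: "i < 2*k" "x = c i" "j < 2*k" "y = c j" using ex xy by meson
  show ?thesis
  proof (cases "i \<le> j")
    case True thus ?thesis using main[of i j] ij by auto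
  next
    case False
    then obtain m where "m \<le> k" "(c j, c i) \<in> A ^^ m" using main[of j i] ij by auto
    thus ?thesis using relpow_sym ij by blast
  qed
qed

lemma d_walk: "x \<in> E \<Longrightarrow> y \<in> E \<Longrightarrow> (x, y) \<in> A ^^ d x y"
  unfolding inc_dist_def using connected LeastI_ex[of "\<lambda>m. (x, y) \<in> A ^^ m"] by blast

lemma d_least: "(x, y) \<in> A ^^ m \<Longrightarrow> d x y \<le> m"
  unfolding inc_dist_def by (rule Least_le)

lemma d_le: "x \<in> E \<Longrightarrow> y \<in> E \<Longrightarrow> d x y \<le> k"
  using connected d_least le_trans by blast

lemma d_eq_0: "x \<in> E \<Longrightarrow> y \<in> E \<Longrightarrow> d x y = 0 \<longleftrightarrow> x = y"
  using d_walk[of x y] d_least[of x x 0] by auto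

lemma d_sym: "d x y = d y x"
proof -
  have "(x, y) \<in> A ^^ m \<longleftrightarrow> (y, x) \<in> A ^^ m" for m using relpow_sym by blast
  thus ?thesis unfolding inc_dist_def by simp
qed

lemma d_triangle:
  assumes "x \<in> E" "y \<in> E" "z \<in> E" shows "d x z \<le> d x y + d y z"
  using d_walk[OF assms(1,2)] d_walk[OF assms(2,3)]
  by (intro d_least) (auto simp: relpow_add)

lemma d_parity: "x \<in> E \<Longrightarrow> y \<in> E \<Longrightarrow> even (d x y) \<longleftrightarrow> (x \<in> P \<longleftrightarrow> y \<in> P)"
  using relpow_parity d_walk by blast

lemma d_adj_le: "(y, z) \<in> A \<Longrightarrow> x \<in> E \<Longrightarrow> d x z \<le> Suc (d x y)"
  using d_walk[of x y] A_E by (intro d_least) auto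

text \<open>In a bipartite graph the distances from \<open>x\<close> to two adjacent elements have
  different parity, so they cannot be equal.\<close>

lemma d_step:
  assumes "(y, z) \<in> A" "x \<in> E"
  shows "d x z = Suc (d x y) \<or> d x y = Suc (d x z)"
proof -
  have yz: "y \<in> E" "z \<in> E" using A_E assms by auto
  have "y \<in> P \<longleftrightarrow> z \<notin> P" using A_P[OF assms(1)] PL yz by auto
  hence "even (d x y) \<noteq> even (d x z)" using d_parity assms yz by auto
  thus ?thesis using d_adj_le[OF assms] d_adj_le[OF A_sym[OF assms(1)] assms(2)]
    by (metis le_SucE le_antisym)
qed

lemma d_pred:
  assumes "x \<in> E" "y \<in> E" "d x y = Suc m"
  obtains z where "(z, y) \<in> A" "d x z = m"
proof -
  obtain z where z: "(x, z) \<in> A ^^ m" "(z, y) \<in> A" using d_walk[OF assms(1,2)] assms(3) by auto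
  have "d x z \<le> m" using d_least z(1) by blast
  with d_adj_le[OF z(2) assms(1)] assms(3) have "d x z = m" by simp
  thus ?thesis using z that by blast
qed

lemma geodesic:
  assumes "x \<in> E" "y \<in> E"
  obtains g where "g 0 = x" "g (d x y) = y" "\<And>i. i < d x y \<Longrightarrow> (g i, g (Suc i)) \<in> A"
    "\<And>i. i \<le> d x y \<Longrightarrow> d x (g i) = i" "\<And>i. i \<le> d x y \<Longrightarrow> g i \<in> E"
proof -
  obtain g where g: "g 0 = x" "g (d x y) = y" "\<And>i. i < d x y \<Longrightarrow> (g i, g (Suc i)) \<in> A"
    using d_walk[OF assms] unfolding relpow_fun_conv by blast
  have gE: "g i \<in> E" if "i \<le> d x y" for i
    using that assms g A_E by (cases "i = d x y") (auto simp: le_less)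
  have 1: "d x (g i) \<le> i" if "i \<le> d x y" for i
    using that
  proof (induction i)
    case 0 thus ?case using assms g d_eq_0 by auto
  next
    case (Suc i) thus ?case using d_adj_le[OF g(3) assms(1), of i] by auto
  qed
  \<comment> \<open>The rest of the walk, from \<open>g i\<close> to \<open>y\<close>, supplies the
    lower bound \<open>i \<le> d x (g i)\<close>.\<close>
  have "d x y \<le> d x (g i) + (d x y - i)" if "i \<le> d x y" for i
  proof -
    have "d x (g (i + m)) \<le> d x (g i) + m" if "i + m \<le> d x y" for m
      using that
    proof (induction m)
      case (Suc m) thus ?case using d_adj_le[OF g(3) assms(1), of "i+m"] by auto
    qed auto
    from this[of "d x y - i"] that g show ?thesis by auto
  qed
  hence "d x (g i) = i" if "i \<le> d x y" for i using 1[OF that] that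
    by (metis add_diff_cancel_right' diff_diff_cancel diff_le_mono le_antisym)
  thus ?thesis using that g gE by blast
qed

text \<open>A counterexample with \<open>d x y\<close> minimal consists of two geodesics from \<open>x\<close> to \<open>y\<close>
  that together form a chordless circuit of length \<open>2 * d x y\<close>.\<close>

lemma pred_unique:
  assumes "x \<in> E" "(z, y) \<in> A" "(z', y) \<in> A" "d x y < k"
    "d x y = Suc (d x z)" "d x y = Suc (d x z')"
  shows "z = z'"
  using assms
proof (induction "d x y" arbitrary: x y z z' rule: less_induct)
  case less
  let ?e = "d x y"
  show ?case
  proof (rule ccontr)
    assume neq: "z \<noteq> z'"
    have E: "x \<in> E" "y \<in> E" "z \<in> E" "z' \<in> E" using less.prems A_E by auto
    \<comment> \<open>Minimality of the counterexample: predecessors are unique at all smaller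
      distances.\<close>
    have uniq: "u = u'" if "x1 \<in> E" "(u, y1) \<in> A" "(u', y1) \<in> A" "d x1 y1 < ?e"
      "d x1 y1 = Suc (d x1 u)" "d x1 y1 = Suc (d x1 u')" for x1 y1 u u'
      using less.hyps[of x1 y1 u u'] that less.prems(4) by auto
    have e2: "?e \<ge> 2"
    proof (rule ccontr)
      assume "\<not> ?e \<ge> 2"
      hence "d x z = 0" "d x z' = 0" using less.prems by auto
      thus False using d_eq_0 E neq by auto
    qed
    have path: "\<exists>g. g 0 = x \<and> g ?e = y \<and> g (?e - 1) = u \<and> (\<forall>i<?e. (g i, g (Suc i)) \<in> A) \<and>
       (\<forall>i\<le>?e. d x (g i) = i \<and> g i \<in> E)" if u: "(u, y) \<in> A" "?e = Suc (d x u)" for u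
    proof -
      have uE: "u \<in> E" using u A_E by auto
      obtain g where g: "g 0 = x" "g (d x u) = u" "\<And>i. i < d x u \<Longrightarrow> (g i, g (Suc i)) \<in> A"
        "\<And>i. i \<le> d x u \<Longrightarrow> d x (g i) = i" "\<And>i. i \<le> d x u \<Longrightarrow> g i \<in> E"
        using geodesic[OF E(1) uE] by blast
      let ?g = "g(?e := y)"
      have "?g 0 = x" "?g ?e = y" "?g (?e - 1) = u" using g u by auto
      moreover have "(?g i, ?g (Suc i)) \<in> A" if "i < ?e" for i
        using that g u by (cases "i = d x u") auto
      moreover have "d x (?g i) = i \<and> ?g i \<in> E" if "i \<le> ?e" for i
        using that g u E by (cases "i = ?e") auto
      ultimately show ?thesis by blast
    qed
    obtain a where a: "a 0 = x" "a ?e = y" "a (?e - 1) = z" "\<And>i. i < ?e \<Longrightarrow> (a i, a (Suc i)) \<in> A"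
       "\<And>i. i \<le> ?e \<Longrightarrow> d x (a i) = i" "\<And>i. i \<le> ?e \<Longrightarrow> a i \<in> E"
      using path[OF less.prems(2,5)] by blast
    obtain b where b: "b 0 = x" "b ?e = y" "b (?e - 1) = z'" "\<And>i. i < ?e \<Longrightarrow> (b i, b (Suc i)) \<in> A"
       "\<And>i. i \<le> ?e \<Longrightarrow> d x (b i) = i" "\<And>i. i \<le> ?e \<Longrightarrow> b i \<in> E"
      using path[OF less.prems(3,6)] by blast
    \<comment> \<open>What remains of the geodesic after \<open>g i\<close> is a geodesic to
      \<open>y\<close> whose last step starts at \<open>u\<close>.\<close>
    have sub: "d (g i) y = Suc (d (g i) u)" "d (g i) y = ?e - i"
      if g: "g (?e - 1) = u" "\<And>i. i < ?e \<Longrightarrow> (g i, g (Suc i)) \<in> A"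
       "\<And>i. i \<le> ?e \<Longrightarrow> d x (g i) = i" "\<And>i. i \<le> ?e \<Longrightarrow> g i \<in> E" "g ?e = y" "i < ?e" for g u i
    proof -
      have w: "(g i, g (i + m)) \<in> A ^^ m" if "i + m \<le> ?e" for m
        using that by (induction m) (use g in auto)
      have "d (g i) u \<le> ?e - 1 - i" using w[of "?e - 1 - i"] g d_least by force
      moreover have "d (g i) y \<le> ?e - i" using w[of "?e - i"] g d_least by force
      moreover have "?e \<le> i + d (g i) y" using d_triangle[of x "g i" y] g E by force
      moreover have "(u, y) \<in> A" using g(2)[of "?e - 1"] g(1,5) e2 by simp
      then have "d (g i) y \<le> Suc (d (g i) u)" using d_adj_le g by auto
      ultimately show "d (g i) y = Suc (d (g i) u)" "d (g i) y = ?e - i" using g(6) by linarith+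
    qed
    \<comment> \<open>A common inner element would be closer to \<open>y\<close> than
      \<open>x\<close> is, and both \<open>z\<close> and \<open>z'\<close> would be predecessors of
      \<open>y\<close> as seen from it. So the geodesics meet only in their ends.\<close>
    have ab: "a i \<noteq> b i" if i: "0 < i" "i < ?e" for i
    proof
      assume eq: "a i = b i"
      have "d (a i) y = Suc (d (a i) z)" "d (a i) y = ?e - i" using sub[of a z i] a i by auto
      moreover have "d (a i) y = Suc (d (a i) z')" using sub[of b z' i] b i eq by auto
      ultimately have "z = z'" using uniq[of "a i" z y z'] less.prems a(6)[of i] i by auto
      thus False using neq by simp
    qed
    \<comment> \<open>\<open>c\<close> follows \<open>a\<close> from \<open>x\<close> to
      \<open>y\<close> and returns along \<open>b\<close>; \<open>lev\<close> is the distance from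
      \<open>x\<close>.\<close>
    define c where "c i = (if i \<le> ?e then a i else b (2 * ?e - i))" for i
    define lev where "lev i = (if i \<le> ?e then i else 2 * ?e - i)" for i
    have lev_c: "d x (c i) = lev i" "c i \<in> E" if "i < 2 * ?e" for i
      using that a b by (auto simp: c_def lev_def)
    have inj: "inj_on c {..<2 * ?e}"
    proof (rule inj_onI)
      fix i j assume ij: "i \<in> {..<2 * ?e}" "j \<in> {..<2 * ?e}" "c i = c j"
      hence l: "lev i = lev j" using lev_c by (metis lessThan_iff)
      show "i = j"
      proof (rule ccontr)
        assume "i \<noteq> j"
        hence "(i < ?e \<and> j > ?e \<and> i = 2 * ?e - j) \<or> (j < ?e \<and> i > ?e \<and> j = 2 * ?e - i)"
          using l ij by (auto simp: lev_def split: if_splits)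
        thus False using ij ab[of i] ab[of j] by (auto simp: c_def)
      qed
    qed
    have consec: "(c i, c (Suc i mod (2 * ?e))) \<in> A" if i: "i < 2 * ?e" for i
    proof -
      consider "i < ?e" | "i \<ge> ?e" "Suc i < 2 * ?e" | "i \<ge> ?e" "Suc i = 2 * ?e" using i by linarith
      thus ?thesis
      proof cases
        case 1 thus ?thesis using a(4)[of i] by (simp add: c_def)
      next
        case 2
        have "c i = b (2 * ?e - i)" using 2 a b by (auto simp: c_def)
        moreover have "c (Suc i) = b (2 * ?e - Suc i)" using 2 by (auto simp: c_def)
        moreover have "(b (2 * ?e - Suc i), b (Suc (2 * ?e - Suc i))) \<in> A" using 2 e2 by (intro b) auto
        moreover have "Suc (2 * ?e - Suc i) = 2 * ?e - i" using 2 by auto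
        ultimately show ?thesis using 2 A_sym by auto
      next
        case 3
        have "2 * ?e - i = 1" using 3 by simp
        hence "c i = b 1" using 3 e2 by (auto simp: c_def)
        moreover have "c (Suc i mod (2 * ?e)) = b 0" using 3 a b by (auto simp: c_def)
        moreover have "(b 0, b 1) \<in> A" using b(4)[of 0] e2 by simp
        ultimately show ?thesis using A_sym by auto
      qed
    qed
    \<comment> \<open>Edges join consecutive levels. If the farther end is not \<open>y\<close>, by
      minimality it has only one neighbour nearer to \<open>x\<close>, namely one of its neighbours
      on the circuit. If it is \<open>y\<close>, both elements of the circuit one level below are
      next to it on the circuit.\<close>
    have up: "i' = Suc i mod (2 * ?e) \<or> i = Suc i' mod (2 * ?e)"
      if i: "i < 2 * ?e" "i' < 2 * ?e" and adj: "(c i, c i') \<in> A" and lv: "lev i' = Suc (lev i)" for i i'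
    proof -
      consider "i' = ?e" | "i' < ?e" | "i' > ?e" by linarith
      thus ?thesis
      proof cases
        case 1
        hence "Suc (lev i) = ?e" using lv by (simp add: lev_def)
        hence "Suc i = ?e \<or> i = Suc ?e" using i by (auto simp: lev_def split: if_splits)
        thus ?thesis using 1 i by auto
      next
        case 2
        hence i0: "0 < i'" using lv by (auto simp: lev_def)
        define j where "j = i' - 1"
        have j: "i' = Suc j" "j < ?e" "j < 2 * ?e" "lev j = lev i" using i0 2 lv by (auto simp: j_def lev_def)
        have "(c j, c i') \<in> A" using consec[of j] j i by simp
        hence "c i = c j"
          using uniq[of x "c i" "c i'" "c j"] E lev_c i j lv adj 2 by (auto simp: lev_def)
        hence "i = j" using inj i j by (auto dest: inj_onD)
        thus ?thesis using j i by auto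
      next
        case 3
        define j where "j = Suc i' mod (2 * ?e)"
        have jl: "j < 2 * ?e" using i by (auto simp: j_def)
        have "lev j = 2 * ?e - Suc i'"
          using 3 i by (cases "Suc i' = 2 * ?e") (auto simp: j_def lev_def)
        hence j: "lev i' = Suc (lev j)" using 3 i by (auto simp: lev_def)
        have "(c j, c i') \<in> A" using consec[of i'] i A_sym by (auto simp: j_def)
        hence "c i = c j"
          using uniq[of x "c i" "c i'" "c j"] E lev_c i j jl lv adj 3 by (auto simp: lev_def)
        hence "i = j" using inj i jl by (auto dest: inj_onD)
        thus ?thesis using j_def by auto
      qed
    qed
    have adj: "(c i, c i') \<in> A \<longleftrightarrow> i' = Suc i mod (2 * ?e) \<or> i = Suc i' mod (2 * ?e)"
      if i: "i < 2 * ?e" "i' < 2 * ?e" for i i'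
    proof
      assume ad: "(c i, c i') \<in> A"
      have "lev i' = Suc (lev i) \<or> lev i = Suc (lev i')"
        using d_step[OF ad E(1)] lev_c i by auto
      thus "i' = Suc i mod (2 * ?e) \<or> i = Suc i' mod (2 * ?e)"
        using up[of i i'] up[of i' i] i ad A_sym by blast
    next
      assume "i' = Suc i mod (2 * ?e) \<or> i = Suc i' mod (2 * ?e)"
      thus "(c i, c i') \<in> A" using consec i A_sym by blast
    qed
    have par: "even i \<longleftrightarrow> even (lev i)" if "i < 2 * ?e" for i using that by (auto simp: lev_def)
    have "\<exists>\<Delta>. ordinary_polygon ?e \<Delta> \<and> subgeometry \<Delta> \<Gamma>"
    proof (cases "x \<in> P")
      case True
      show ?thesis
      proof (rule ordinary_polygon_of_induced_cycle[OF plg e2 inj])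
        fix i assume i: "i < 2 * ?e"
        have "c i \<in> P \<longleftrightarrow> even i" "c i \<in> E"
          using par lev_c i d_parity[OF E(1), of "c i"] True by auto
        thus "even i \<Longrightarrow> c i \<in> P" "odd i \<Longrightarrow> c i \<in> L" using PL by auto
      qed (rule adj)
    next
      case False
      \<comment> \<open>Here \<open>x\<close> is a line; the circuit is shifted by one place to
        start at a point.\<close>
      define c' where "c' i = c (Suc i mod (2 * ?e))" for i
      have lt: "Suc i mod (2 * ?e) < 2 * ?e" for i using e2 by auto
      have sinj: "Suc i mod (2 * ?e) = Suc j mod (2 * ?e) \<longleftrightarrow> i = j" if "i < 2 * ?e" "j < 2 * ?e" for i j
        using that by (auto simp: mod_Suc split: if_splits)
      show ?thesis
      proof (rule ordinary_polygon_of_induced_cycle[OF plg e2])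
        show "inj_on c' {..<2 * ?e}"
        proof (rule inj_onI)
          fix i j assume ij: "i \<in> {..<2 * ?e}" "j \<in> {..<2 * ?e}" "c' i = c' j"
          hence "Suc i mod (2 * ?e) = Suc j mod (2 * ?e)"
            unfolding c'_def using inj_onD[OF inj, of "Suc i mod (2 * ?e)" "Suc j mod (2 * ?e)"] lt by blast
          thus "i = j" using sinj ij by blast
        qed
      next
        fix i assume i: "i < 2 * ?e"
        have ev: "even (Suc i mod (2 * ?e)) \<longleftrightarrow> odd i" by (simp add: dvd_mod_iff)
        note f = lev_c[OF lt[of i]] par[OF lt[of i]]
        have "c' i \<in> P \<longleftrightarrow> even i" "c' i \<in> E"
          using ev f d_parity[OF E(1), of "c' i"] False unfolding c'_def by auto
        thus "even i \<Longrightarrow> c' i \<in> P" "odd i \<Longrightarrow> c' i \<in> L" using PL by auto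
      next
        fix i i' assume i: "i < 2 * ?e" "i' < 2 * ?e"
        show "(c' i, c' i') \<in> A \<longleftrightarrow> i' = Suc i mod (2 * ?e) \<or> i = Suc i' mod (2 * ?e)"
        proof -
          have "(c' i, c' i') \<in> A \<longleftrightarrow> Suc i' mod (2 * ?e) = Suc (Suc i mod (2 * ?e)) mod (2 * ?e) \<or>
              Suc i mod (2 * ?e) = Suc (Suc i' mod (2 * ?e)) mod (2 * ?e)"
            unfolding c'_def by (rule adj[OF lt lt])
          thus ?thesis using sinj[OF i(2) lt[of i]] sinj[OF i(1) lt[of i']] by simp
        qed
      qed
    qed
    thus False using gp e2 less.prems(4) unfolding generalised_polygon_def by blast
  qed
qed

text \<open>The later matrix products are computed from this count and the sizes of point rows and
  line pencils.\<close>

lemma card_pred: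
  assumes "x \<in> E" "y \<in> E" "0 < d x y" "d x y < k"
  shows "card {z. (y, z) \<in> A \<and> d x y = Suc (d x z)} = 1"
proof -
  obtain z where z: "(z, y) \<in> A" "d x z = d x y - 1"
    using d_pred[OF assms(1,2), of "d x y - 1"] assms(3) by auto
  have "{z. (y, z) \<in> A \<and> d x y = Suc (d x z)} = {z}"
  proof (intro equalityI subsetI)
    fix w assume "w \<in> {z. (y, z) \<in> A \<and> d x y = Suc (d x z)}"
    thus "w \<in> {z}" using pred_unique[OF assms(1) _ z(1) assms(4)] A_sym z(2) by simp
  next
    fix w assume "w \<in> {z}"
    thus "w \<in> {z. (y, z) \<in> A \<and> d x y = Suc (d x z)}" using A_sym z assms(3) by simp
  qed
  thus ?thesis by simp
qed

end

section \<open>Traces of periodic matrices\<close>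

definition mat_trace :: "'a :: comm_monoid_add mat \<Rightarrow> 'a" where
  "mat_trace X = (\<Sum>i<dim_row X. X $$ (i, i))"

lemma mat_trace_comm:
  fixes X Y :: "'a :: comm_semiring_0 mat"
  assumes X: "X \<in> carrier_mat n m" and Y: "Y \<in> carrier_mat m n"
  shows "mat_trace (X * Y) = mat_trace (Y * X)"
proof -
  have "mat_trace (X * Y) = (\<Sum>i<n. \<Sum>j<m. X $$ (i, j) * Y $$ (j, i))"
    using X Y by (auto simp: mat_trace_def scalar_prod_def atLeast0LessThan)
  also have "\<dots> = (\<Sum>j<m. \<Sum>i<n. Y $$ (j, i) * X $$ (i, j))"
    by (subst sum.swap) (simp add: mult.commute)
  also have "\<dots> = mat_trace (Y * X)"
    using X Y by (auto simp: mat_trace_def scalar_prod_def atLeast0LessThan)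
  finally show ?thesis .
qed

text \<open>\<open>es\<close> is the diagonal of a Schur triangular form; it is a list because
  eigenvalues may repeat.\<close>

lemma mat_trace_eigenvalues:
  fixes Y :: "complex mat"
  assumes Y: "Y \<in> carrier_mat n n"
  obtains es where "mat_trace Y = sum_list es" "\<And>e. e \<in> set es \<Longrightarrow> eigenvalue Y e"
proof -
  obtain es where es: "char_poly Y = (\<Prod>e\<leftarrow>es. [:- e, 1:])"
    using char_poly_factorized[OF Y] by blast
  obtain B R Q where sd: "schur_decomposition Y es = (B, R, Q)"
    by (cases "schur_decomposition Y es")
  from schur_decomposition[OF Y es sd]
  have sim: "similar_mat_wit Y B R Q" and diag: "diag_mat B = es" by auto
  note w = similar_mat_witD2[OF Y sim]
  have "mat_trace Y = mat_trace (Q * (R * B))"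
    using w mat_trace_comm[of "R * B" n n Q] by auto
  also have "Q * (R * B) = B" using w by (simp flip: assoc_mult_mat[of Q n n R n B n])
  also have "mat_trace B = sum_list es"
    by (simp add: mat_trace_def flip: diag, simp add: diag_mat_def sum_list_sum_nth atLeast0LessThan)
  finally have "mat_trace Y = sum_list es" .
  moreover have "eigenvalue Y e" if "e \<in> set es" for e
  proof -
    have "poly (char_poly Y) e = 0" unfolding es using that
      by (induction es) auto
    thus ?thesis using eigenvalue_root_char_poly[OF Y] by simp
  qed
  ultimately show ?thesis using that by blast
qed

text \<open>\<open>x\<close> is a root of the characteristic polynomial of \<open>C\<close>, which
  is monic with integer coefficients.\<close>

lemma algebraic_int_eigenvalue_int_mat:
  fixes C :: "nat \<Rightarrow> nat \<Rightarrow> int" and x :: complex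
  assumes eq: "\<And>i. i < m \<Longrightarrow> (\<Sum>j<m. of_int (C i j) * v j) = x * v i"
    and nz: "i0 < m" "v i0 \<noteq> 0"
  shows "algebraic_int x"
proof -
  define A where "A = mat m m (\<lambda>(i, j). C i j)"
  have A: "A \<in> carrier_mat m m" by (simp add: A_def)
  let ?A = "map_mat of_int A :: complex mat"
  have A': "?A \<in> carrier_mat m m" using A by simp
  have "?A *\<^sub>v vec m v = x \<cdot>\<^sub>v vec m v"
  proof (rule eq_vecI)
    fix i assume "i < dim_vec (x \<cdot>\<^sub>v vec m v)"
    thus "(?A *\<^sub>v vec m v) $ i = (x \<cdot>\<^sub>v vec m v) $ i"
      using eq[of i] by (simp add: A_def scalar_prod_def atLeast0LessThan)
  qed (simp add: A_def)
  moreover have "vec m v \<noteq> 0\<^sub>v m" using nz by (auto simp: vec_eq_iff)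
  ultimately have "eigenvalue ?A x"
    unfolding eigenvalue_def eigenvector_def using A' by (intro exI[of _ "vec m v"]) auto
  hence "poly (char_poly ?A) x = 0" using eigenvalue_root_char_poly[OF A'] by simp
  moreover have "char_poly ?A = map_poly of_int (char_poly A)"
    using of_int_hom.char_poly_hom[OF A] by simp
  ultimately show ?thesis
    using degree_monic_char_poly[OF A] unfolding algebraic_int_altdef_ipoly by auto
qed

lemma algebraic_int_sum_roots_of_unity:
  fixes es :: "complex list"
  assumes m: "m > 0" and es: "\<And>e. e \<in> set es \<Longrightarrow> e = 0 \<or> e ^ m = 1"
  shows "algebraic_int (sum_list es)"
proof -
  define \<zeta> where "\<zeta> = cis (2 * pi / m)"
  have \<zeta>m: "\<zeta> ^ m = 1" using m by (simp add: \<zeta>_def DeMoivre)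
  have "\<exists>C :: nat \<Rightarrow> nat \<Rightarrow> int. \<forall>i<m. (\<Sum>j<m. of_int (C i j) * \<zeta> ^ j) = sum_list es * \<zeta> ^ i"
    using es
  proof (induction es)
    case Nil
    show ?case by (intro exI[of _ "\<lambda>_ _. 0"]) simp
  next
    case (Cons e es)
    then obtain C :: "nat \<Rightarrow> nat \<Rightarrow> int"
      where C: "\<And>i. i < m \<Longrightarrow> (\<Sum>j<m. of_int (C i j) * \<zeta> ^ j) = sum_list es * \<zeta> ^ i" by auto
    have "\<exists>D :: nat \<Rightarrow> nat \<Rightarrow> int. \<forall>i<m. (\<Sum>j<m. of_int (D i j) * \<zeta> ^ j) = e * \<zeta> ^ i"
    proof (cases "e = 0")
      case True
      thus ?thesis by (intro exI[of _ "\<lambda>_ _. 0"]) simp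
    next
      case False
      hence "e ^ m = 1" using Cons.prems by auto
      hence "e \<in> (\<lambda>k. cis (2 * pi * real k / real m)) ` {..<m}"
        using bij_betw_roots_unity[OF m] unfolding bij_betw_def by auto
      then obtain l where "e = cis (2 * pi * real l / real m)" by auto
      hence e: "e = \<zeta> ^ l" by (simp add: \<zeta>_def DeMoivre mult_ac)
      \<comment> \<open>The matrix of multiplication by \<open>e\<close> is a permutation matrix:
        row \<open>i\<close> has its one in column \<open>(i + l) mod m\<close>.\<close>
      have "(\<Sum>j<m. of_int (if j = (i + l) mod m then 1 else 0) * \<zeta> ^ j) = e * \<zeta> ^ i" for i
      proof -
        have "(\<Sum>j<m. of_int (if j = (i + l) mod m then 1 else 0) * \<zeta> ^ j)
            = (\<Sum>j<m. if j = (i + l) mod m then \<zeta> ^ j else 0)"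
          by (intro sum.cong) auto
        also have "\<dots> = \<zeta> ^ ((i + l) mod m)" using m by simp
        also have "\<dots> = \<zeta> ^ (m * ((i + l) div m) + (i + l) mod m)"
          by (simp only: power_add power_mult \<zeta>m) simp
        also have "\<dots> = e * \<zeta> ^ i" by (simp add: e power_add)
        finally show ?thesis .
      qed
      thus ?thesis by (intro exI[of _ "\<lambda>i j. if j = (i + l) mod m then 1 else 0"]) simp
    qed
    then obtain D :: "nat \<Rightarrow> nat \<Rightarrow> int"
      where D: "\<And>i. i < m \<Longrightarrow> (\<Sum>j<m. of_int (D i j) * \<zeta> ^ j) = e * \<zeta> ^ i" by auto
    show ?case
      by (intro exI[of _ "\<lambda>i j. D i j + C i j"])
        (simp add: ring_distribs sum.distrib C D)
  qed
  then obtain C :: "nat \<Rightarrow> nat \<Rightarrow> int"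
    where "\<And>i. i < m \<Longrightarrow> (\<Sum>j<m. of_int (C i j) * \<zeta> ^ j) = sum_list es * \<zeta> ^ i" by auto
  moreover have "\<zeta> ^ (0::nat) \<noteq> 0" by (simp only: power_0) simp
  ultimately show ?thesis
    using m by (intro algebraic_int_eigenvalue_int_mat[of m C "\<lambda>j. \<zeta> ^ j" _ 0])
qed

text \<open>The period is stated without inverting \<open>Y\<close>, since \<open>Y\<close> will be
  a projection times a permutation matrix and thus singular in general.\<close>

lemma eigenvalue_periodic_mat:
  fixes Y :: "'a :: field mat"
  assumes Y: "Y \<in> carrier_mat n n" and per: "Y ^\<^sub>m (Suc m) = Y" and ev: "eigenvalue Y e"
  shows "e = 0 \<or> e ^ m = 1"
proof -
  obtain v where v: "eigenvector Y v e" using ev unfolding eigenvalue_def by blast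
  hence vn: "v \<in> carrier_vec n" "v \<noteq> 0\<^sub>v n" "Y *\<^sub>v v = e \<cdot>\<^sub>v v"
    using Y unfolding eigenvector_def by auto
  have eq: "e ^ Suc m \<cdot>\<^sub>v v = e \<cdot>\<^sub>v v"
    using eigenvector_pow[OF Y v, of "Suc m"] vn per by metis
  obtain i where "i < n" "v $ i \<noteq> 0" using vn by (metis eq_vecI carrier_vecD index_zero_vec)
  moreover have "(e ^ Suc m \<cdot>\<^sub>v v) $ i = (e \<cdot>\<^sub>v v) $ i" using eq by simp
  ultimately have "e ^ Suc m = e" using vn by auto
  thus ?thesis by auto
qed

lemma algebraic_int_mat_trace_periodic:
  fixes Y :: "complex mat"
  assumes "Y \<in> carrier_mat n n" "Y ^\<^sub>m (Suc m) = Y" "m > 0"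
  shows "algebraic_int (mat_trace Y)"
  using mat_trace_eigenvalues[OF assms(1)] eigenvalue_periodic_mat[OF assms(1,2)]
    algebraic_int_sum_roots_of_unity[OF assms(3)] by metis

text \<open>This is the case of period one, where every eigenvalue is 0 or 1.\<close>

lemma mat_trace_idempotent:
  fixes Y :: "complex mat"
  assumes Y: "Y \<in> carrier_mat n n" and "Y * Y = Y"
  shows "mat_trace Y \<in> \<nat>"
proof -
  obtain es where es: "mat_trace Y = sum_list es" "\<And>e. e \<in> set es \<Longrightarrow> eigenvalue Y e"
    using mat_trace_eigenvalues[OF Y] by blast
  have "Y ^\<^sub>m Suc 1 = Y" using assms by simp
  hence "e = 0 \<or> e ^ 1 = 1" if "e \<in> set es" for e
    using eigenvalue_periodic_mat[OF Y _ es(2)[OF that]] by blast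
  hence "set es \<subseteq> \<nat>" by fastforce
  hence "sum_list es \<in> \<nat>" by (induction es) auto
  thus ?thesis using es by simp
qed

section \<open>Diophantine conditions on the parameters\<close>

text \<open>Vieta descent on \<open>a + b\<close>. If \<open>a < b\<close>, the other root
  \<open>c = m * a - b\<close> of the quadratic in \<open>b\<close> satisfies
  \<open>b * c = a\<^sup>2 + 1\<close>, hence \<open>0 < c < b\<close>. The descent ends at
  \<open>a = b\<close>, where \<open>a\<^sup>2\<close> divides 1.\<close>

lemma vieta_hexagon:
  fixes a b m :: int
  assumes "a > 0" "b > 0" "a\<^sup>2 + b\<^sup>2 + 1 = m * a * b"
  shows "m = 3"
  using assms
proof (induction "nat (a + b)" arbitrary: a b rule: less_induct)
  case less
  have *: "m = 3" if ab: "a \<le> b" "a > 0" "b > 0" "a\<^sup>2 + b\<^sup>2 + 1 = m * a * b"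
    and IH: "\<And>c. c > 0 \<Longrightarrow> c < b \<Longrightarrow> a\<^sup>2 + c\<^sup>2 + 1 = m * a * c \<Longrightarrow> m = 3" for a b :: int
  proof (cases "a = b")
    case True
    hence "a * a dvd 1 + 2 * (a * a)" "a * a dvd 2 * (a * a)"
      using ab by (auto simp: power2_eq_square algebra_simps intro: dvdI[of _ _ m])
    hence "a * a dvd 1" by (simp add: dvd_add_left_iff)
    hence "a dvd 1" by (rule dvd_mult_left)
    hence "a = 1" using ab by simp
    moreover from this have "b = 1" using True by simp
    ultimately show ?thesis using ab(4) by simp
  next
    case False
    define c where "c = m * a - b"
    have bc: "b * c = a\<^sup>2 + 1" using ab by (simp add: c_def power2_eq_square algebra_simps)
    have "b * c > 0" using bc zero_le_power2[of a] by linarith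
    hence "c > 0" using ab(3) by (simp add: zero_less_mult_iff)
    moreover have "c < b"
    proof (rule ccontr)
      assume "\<not> c < b"
      hence "b * b \<le> b * c" using ab by simp
      moreover have "(a + 1) * (a + 1) \<le> b * b" using ab False by (intro mult_mono) auto
      ultimately show False using bc ab by (simp add: power2_eq_square algebra_simps)
    qed
    moreover have "a\<^sup>2 + c\<^sup>2 + 1 = m * a * c" using bc by (simp add: c_def power2_eq_square algebra_simps)
    ultimately show ?thesis using IH by blast
  qed
  show ?case
  proof (cases "a \<le> b")
    case True
    have IH: "m = 3" if "c > 0" "c < b" "a\<^sup>2 + c\<^sup>2 + 1 = m * a * c" for c
      using less.hyps[of a c] that less.prems by auto
    show ?thesis by (rule *[OF True less.prems IH])
  next
    case False
    have IH: "m = 3" if "c > 0" "c < a" "b\<^sup>2 + c\<^sup>2 + 1 = m * b * c" for c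
      using less.hyps[of c b] that less.prems by (auto simp: ac_simps)
    have eq: "b\<^sup>2 + a\<^sup>2 + 1 = m * b * a" using less.prems by (simp add: ac_simps)
    show ?thesis by (rule *[OF _ less.prems(2,1) eq IH]) (use False in auto)
  qed
qed

text \<open>The equation is quadratic in each variable, so there are two descents: \<open>b\<close>
  to \<open>c\<close> with \<open>b * c = 2 * a\<^sup>2 + 1\<close>, and \<open>a\<close> to
  \<open>e\<close> with \<open>2 * a * e = b\<^sup>2 + 1\<close>. If neither descends, then
  \<open>b\<^sup>2 - 2 * a\<^sup>2\<close> is -1, 0 or 1, and only -1 survives, with
  \<open>a = b = 1\<close>.\<close>

lemma vieta_octagon:
  fixes a b m :: int
  assumes "a > 0" "b > 0" "2 * a\<^sup>2 + b\<^sup>2 + 1 = 2 * m * a * b"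
  shows "m = 2"
  using assms
proof (induction "nat (a + b)" arbitrary: a b rule: less_induct)
  case (less a b)
  have m: "m > 0"
  proof -
    have "2 * a\<^sup>2 + b\<^sup>2 + 1 > 0" using zero_le_power2[of a] zero_le_power2[of b] by linarith
    hence "m * (2 * (a * b)) > 0" using less.prems by (simp add: algebra_simps)
    moreover have "a * b > 0" using less.prems by simp
    ultimately show ?thesis by (simp add: zero_less_mult_iff)
  qed
  define c where "c = 2 * m * a - b"
  have bc: "b * c = 2 * a\<^sup>2 + 1" using less.prems by (simp add: c_def power2_eq_square algebra_simps)
  hence c0: "c > 0" using less.prems by (smt (verit) zero_le_power2 zero_less_mult_iff)
  define e where "e = m * b - a"
  have ae: "2 * (a * e) = b\<^sup>2 + 1" using less.prems by (simp add: e_def power2_eq_square algebra_simps)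
  hence e0: "e > 0" using less.prems by (smt (verit) zero_le_power2 zero_less_mult_iff)
  consider "c < b" | "e < a" | "c \<ge> b" "e \<ge> a" by linarith
  thus ?case
  proof cases
    case 1
    have "2 * a\<^sup>2 + c\<^sup>2 + 1 = 2 * m * a * c" using bc by (simp add: c_def power2_eq_square algebra_simps)
    thus ?thesis using less.hyps[of a c] 1 c0 less.prems by simp
  next
    case 2
    have "2 * e\<^sup>2 + b\<^sup>2 + 1 = 2 * m * e * b" using ae by (simp add: e_def power2_eq_square algebra_simps)
    thus ?thesis using less.hyps[of e b] 2 e0 less.prems by simp
  next
    case 3
    have "b * b \<le> b * c" "a * a \<le> a * e" using 3 less.prems by auto
    hence "b\<^sup>2 \<le> 2 * a\<^sup>2 + 1" "2 * a\<^sup>2 \<le> b\<^sup>2 + 1" using bc ae by (auto simp: power2_eq_square)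
    then consider "b\<^sup>2 = 2 * a\<^sup>2 - 1" | "b\<^sup>2 = 2 * a\<^sup>2" | "b\<^sup>2 = 2 * a\<^sup>2 + 1" by linarith
    thus ?thesis
    proof cases
      case 1
      have "2 * a * (2 * a - m * b) = (2 * a\<^sup>2 + b\<^sup>2 + 1 - 2 * m * a * b) + (2 * a\<^sup>2 - 1 - b\<^sup>2)"
        by (simp add: power2_eq_square algebra_simps)
      hence "2 * a * (2 * a - m * b) = 0" using less.prems 1 by simp
      hence eq: "2 * a = m * b" using less.prems by (simp only: mult_eq_0_iff) auto
      \<comment> \<open>Together with \<open>4 * a\<^sup>2 = 2 * b\<^sup>2 + 2\<close> this leaves
        \<open>b\<^sup>2 * (m\<^sup>2 - 2) = 2\<close>, which forces \<open>b = 1\<close>.\<close>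
      hence "(m * b)\<^sup>2 = 4 * a\<^sup>2" by (simp add: power_mult_distrib flip: eq)
      moreover have "b\<^sup>2 * (m\<^sup>2 - 2) = (m * b)\<^sup>2 - 2 * b\<^sup>2" by (simp add: power_mult_distrib algebra_simps)
      ultimately have "b\<^sup>2 * (m\<^sup>2 - 2) = 2" using 1 by linarith
      hence "b\<^sup>2 dvd 2" by (metis dvd_triv_left)
      hence "b\<^sup>2 \<le> 2" by (simp add: zdvd_imp_le)
      moreover have "b \<ge> 2 \<Longrightarrow> b\<^sup>2 \<ge> 4" using power_mono[of 2 b 2] by simp
      ultimately have "b = 1" using less.prems by (cases "b \<ge> 2") auto
      hence "a\<^sup>2 = 1" using 1 by simp
      hence "a = 1" using less.prems by (simp add: power2_eq_1_iff)
      thus ?thesis using eq \<open>b = 1\<close> by simp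
    next
      case 2
      hence "2 * (2 * a\<^sup>2) + 1 = 2 * (m * a * b)" using less.prems by (simp add: algebra_simps)
      thus ?thesis by presburger
    next
      case 3
      hence "2 * (2 * a\<^sup>2 + 1) = 2 * (m * a * b)" using less.prems by (simp add: algebra_simps)
      hence "a * (m * b - 2 * a) = 1" by (simp add: power2_eq_square algebra_simps)
      hence "a dvd 1" by (metis dvd_triv_left)
      hence "a = 1" using less.prems by simp
      hence "b\<^sup>2 = 3" using 3 by simp
      moreover have "b \<ge> 2 \<Longrightarrow> b\<^sup>2 \<ge> 4" using power_mono[of 2 b 2] by simp
      moreover have "b < 2 \<Longrightarrow> b = 1" using less.prems by simp
      ultimately show ?thesis by (cases "b \<ge> 2") auto
    qed
  qed
qed

section \<open>Exclusion of coprime parameters\<close>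

lemma coprime_mult_square:
  fixes x y z :: nat
  assumes "coprime x y" "x * y = z\<^sup>2"
  obtains a b where "x = a\<^sup>2" "y = b\<^sup>2"
proof -
  have "is_nth_power 2 (x * y)" using assms by (simp add: is_nth_power_def)
  hence "is_nth_power 2 x" "is_nth_power 2 y"
    using is_nth_power_mult_coprime_nat_iff[OF assms(1)] by auto
  thus ?thesis using that unfolding is_nth_power_def by blast
qed

text \<open>\<open>eq\<close> is the trace condition at the eigenvalue \<open>s + t - u\<close>.
  Modulo \<open>u\<close> it says that \<open>u\<close> divides \<open>1 + s + t\<close>. As
  \<open>s\<close> and \<open>t\<close> are squares, \<open>vieta_hexagon\<close> applies and gives
  \<open>s + t = 3 * u - 1\<close>; then \<open>eq\<close> modulo \<open>2 * u - 1\<close> bounds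
  \<open>u\<close>.\<close>

lemma hexagon_parameters_impossible:
  fixes s t :: nat and u k :: int
  assumes s2: "s \<ge> 2" and t2: "t \<ge> 2" and cop: "coprime s t" and u: "u > 0" "u\<^sup>2 = int (s * t)"
    and eq: "2 * u * (int (s + t) - u) * k = (1 + int s) * (1 + int t) * (1 + u\<^sup>2 - u)"
  shows False
proof -
  have "s * t = (nat u)\<^sup>2" using u by (metis int_nat_eq less_imp_le of_nat_eq_iff of_nat_power)
  then obtain a b where ab: "s = a\<^sup>2" "t = b\<^sup>2" using coprime_mult_square[OF cop] by blast
  have ab0: "a > 0" "b > 0" using ab s2 t2 by (auto intro!: Nat.gr0I)
  have "u\<^sup>2 = (int a * int b)\<^sup>2" using u ab by (simp add: power_mult_distrib)
  hence uab: "u = int a * int b" using u ab0 by (simp add: power2_eq_iff_nonneg)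
  define A where "A = 1 + int s + int t"
  have e1: "(1 + int s) * (1 + int t) = A + u\<^sup>2" using u by (simp add: A_def algebra_simps)
  have "A = u * (2 * (int (s + t) - u) * k - u * (1 + u\<^sup>2 - u) - A * (u - 1))"
    using eq unfolding e1 by (simp add: power2_eq_square algebra_simps)
  then obtain m where m: "A = u * m" by blast
  have "(int a)\<^sup>2 + (int b)\<^sup>2 + 1 = m * int a * int b" using m uab ab by (simp add: A_def algebra_simps)
  hence "m = 3" using vieta_hexagon[of "int a" "int b" m] ab0 by simp
  hence v: "int (s + t) = 3 * u - 1" using m by (simp add: A_def)
  have "A = 3 * u" "int (s + t) - u = 2 * u - 1" using v m \<open>m = 3\<close> by auto
  hence "2 * u * (2 * u - 1) * k = (3 * u + u\<^sup>2) * (1 + u\<^sup>2 - u)"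
    using eq unfolding e1 by simp
  \<comment> \<open>16 times the right-hand side is 21 modulo \<open>2u - 1\<close>: substitute \<open>2u = 1\<close>\<close>
  hence "(2 * u - 1) * (2 * u * k * 16) = 16 * ((3 * u + u\<^sup>2) * (1 + u\<^sup>2 - u))" by (simp add: algebra_simps)
  also have "\<dots> = (2 * u - 1) * (8 * u ^ 3 + 20 * u\<^sup>2 - 6 * u + 21) + 21"
    by (simp add: power2_eq_square power3_eq_cube algebra_simps)
  finally have "(2 * u - 1) * (2 * u * k * 16 - (8 * u ^ 3 + 20 * u\<^sup>2 - 6 * u + 21)) = 21"
    by (simp only: right_diff_distrib)
  hence dvd: "2 * u - 1 dvd 21" by (metis dvd_triv_left)
  hence "2 * u - 1 \<le> 21" by (simp add: zdvd_imp_le)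
  hence "u \<in> {1..11}" using u by simp
  hence "u \<in> {1,2,3,4,5,6,7,8,9,10,11}" by (simp add: atLeastAtMost_iff) presburger
  \<comment> \<open>The divisors 1, 3, 7 and 21 of 21.\<close>
  hence uc: "u = 1 \<or> u = 2 \<or> u = 4 \<or> u = 11" using dvd by auto
  \<comment> \<open>The discriminant of the quadratic with roots \<open>s\<close> and
    \<open>t\<close>. For \<open>u = 4\<close> and \<open>u = 11\<close> it lies strictly between
    consecutive squares.\<close>
  have sq: "(int s - int t)\<^sup>2 = (5 * u - 1) * (u - 1)"
  proof -
    have "(int s - int t)\<^sup>2 = (int (s + t))\<^sup>2 - 4 * int (s * t)"
      by (simp add: power2_eq_square algebra_simps)
    also have "\<dots> = (3 * u - 1)\<^sup>2 - 4 * u\<^sup>2" using u v by simp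
    finally show ?thesis by (simp add: power2_eq_square algebra_simps)
  qed
  have nsq: "z\<^sup>2 \<noteq> q" if "r\<^sup>2 < q" "q < (r + 1)\<^sup>2" "r > 0" for z q r :: int
    using that abs_le_square_iff[of z r] abs_le_square_iff[of "r + 1" z] by auto
  from uc show False
  proof (elim disjE)
    assume "u = 4" thus False using sq nsq[of 7 57 "int s - int t"] by simp
  next
    assume "u = 11" thus False using sq nsq[of 23 540 "int s - int t"] by simp
  next
    assume "u = 1" thus False using v s2 t2 by simp
  next
    assume 2: "u = 2"
    hence "s + t = 5" using v by simp
    moreover have "s * t = 4" using u 2 by (simp flip: of_nat_mult)
    moreover have "s = 2 \<and> t = 3 \<or> s = 3 \<and> t = 2" using s2 t2 \<open>s + t = 5\<close> by arith
    ultimately show False by auto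
  qed
qed

text \<open>\<open>eq\<close> comes from the traces at \<open>s + t + w\<close> and
  \<open>s + t - w\<close>, and \<open>mult\<close> from the multiplicity of \<open>s + t\<close>.
  Modulo \<open>w\<close>, \<open>eq\<close> says that \<open>w\<close> divides
  \<open>1 + s + t\<close>; \<open>vieta_octagon\<close> then gives \<open>s + t = 4 * c - 1\<close>
  with \<open>w = 2 * c\<close>, and \<open>mult\<close> modulo \<open>s + t\<close> bounds
  \<open>c\<close>.\<close>

lemma octagon_parameters_impossible:
  fixes s t :: nat and w k m0 :: int
  assumes s2: "s \<ge> 2" and t2: "t \<ge> 2" and cop: "coprime s t" and w: "w > 0" "w\<^sup>2 = 2 * int (s * t)"
    and eq: "w * k = (1 + int s) * (1 + int t) * (1 + int (s * t))"
    and mult: "2 * int (s + t) * m0 = (1 + int s) * (1 + int t) * int (s * t) * (1 + (int (s * t))\<^sup>2)"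
  shows False
proof -
  define D where "D = int (s * t)"
  define v where "v = int (s + t)"
  have "even w" using w by (metis dvd_triv_left even_power)
  then obtain c where c: "w = 2 * c" by blast
  have c0: "c > 0" using c w by simp
  have Dc: "D = 2 * c\<^sup>2" using w c by (simp add: D_def power2_eq_square)
  have e1: "(1 + int s) * (1 + int t) = 1 + v + D" by (simp add: D_def v_def algebra_simps)
  have "1 + v = w * (k - c * (1 + v + D) - c)"
    using eq unfolding e1 D_def[symmetric] by (simp add: Dc c power2_eq_square algebra_simps)
  then obtain m where m: "1 + v = w * m" by blast
  \<comment> \<open>Stated for \<open>x\<close> and \<open>y\<close> because either of
    \<open>s\<close> and \<open>t\<close> may be the even one; the even one is twice a square, the
    other a square.\<close>
  have key: "m = 2" if st: "even x" "coprime x y" "x \<ge> 2" "y \<ge> 2" "int (x * y) = D" "int (x + y) = v" for x y :: nat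
  proof -
    obtain x' where x': "x = 2 * x'" using st by blast
    have "int (x' * y) = c\<^sup>2" using st x' Dc by simp
    hence "x' * y = (nat c)\<^sup>2" using c0 by (metis int_nat_eq less_imp_le of_nat_eq_iff of_nat_power)
    moreover have "coprime x' y" using st x' by simp
    ultimately obtain a b where ab: "x' = a\<^sup>2" "y = b\<^sup>2" using coprime_mult_square by metis
    have ab0: "a > 0" "b > 0" using ab st x' by (auto intro!: Nat.gr0I)
    have "c\<^sup>2 = (int a * int b)\<^sup>2" using \<open>int (x' * y) = c\<^sup>2\<close> ab by (simp add: power_mult_distrib)
    hence "c = int a * int b" using c0 ab0 by (simp add: power2_eq_iff_nonneg)
    hence "2 * (int a)\<^sup>2 + (int b)\<^sup>2 + 1 = 2 * m * int a * int b"
      using m st(6) c x' ab by (simp add: algebra_simps)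
    thus ?thesis using vieta_octagon[of "int a" "int b" m] ab0 by simp
  qed
  have "even D" using Dc by simp
  hence "even s \<or> even t" by (simp add: D_def)
  hence "m = 2"
    using key[of s t] key[of t s] s2 t2 cop by (auto simp: D_def v_def coprime_commute mult.commute add.commute)
  hence v: "v = 4 * c - 1" using m c by simp
  \<comment> \<open>This allows the factor \<open>D\<close> to be cancelled when \<open>mult\<close>
    is read modulo \<open>v\<close>.\<close>
  have "coprime v D"
  proof -
    have "coprime (s + t) s" "coprime (s + t) t"
      using cop gcd_add2[of t s] by (simp_all add: coprime_iff_gcd_eq_1 gcd.commute add.commute)
    thus ?thesis by (simp add: v_def D_def flip: of_nat_add of_nat_mult)
  qed
  moreover have "v dvd D * ((1 + v + D) * (1 + D\<^sup>2))"
    using mult unfolding e1 D_def[symmetric] v_def[symmetric]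
    by (intro dvdI[of _ _ "2 * m0"]) (simp add: algebra_simps)
  ultimately have "v dvd (1 + v + D) * (1 + D\<^sup>2)" by (simp add: coprime_dvd_mult_right_iff)
  then obtain q where "(1 + v + D) * (1 + D\<^sup>2) = v * q" by blast
  hence "512 * ((1 + v + 2 * c\<^sup>2) * (1 + (2 * c\<^sup>2)\<^sup>2)) = v * (512 * q)" by (simp add: Dc)
  \<comment> \<open>substituting \<open>4c = 1\<close> gives \<open>9 * 65 = 585\<close> modulo \<open>4c - 1\<close>\<close>
  hence "512 * ((4 * c + 2 * c\<^sup>2) * (1 + (2 * c\<^sup>2)\<^sup>2)) = (4 * c - 1) * (512 * q)" by (simp add: v)
  moreover have "512 * ((4 * c + 2 * c\<^sup>2) * (1 + (2 * c\<^sup>2)\<^sup>2))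
     = (4 * c - 1) * (1024 * c ^ 5 + 2304 * c ^ 4 + 576 * c ^ 3 + 144 * c\<^sup>2 + 292 * c + 585) + 585"
    by (simp add: power_numeral_reduce algebra_simps)
  ultimately have "(4 * c - 1) * (512 * q - (1024 * c ^ 5 + 2304 * c ^ 4 + 576 * c ^ 3 + 144 * c\<^sup>2 + 292 * c + 585)) = 585"
    by (simp only: right_diff_distrib)
  hence dvd: "4 * c - 1 dvd 585" by (metis dvd_triv_left)
  have "4 * c - 1 \<le> 585" using dvd by (simp add: zdvd_imp_le)
  hence "c \<in> set [1..146]" using c0 by simp
  \<comment> \<open>The divisors 3, 15, 39 and 195 are the ones congruent to 3 modulo 4.\<close>
  moreover have "list_all (\<lambda>c::int. 4 * c - 1 dvd 585 \<longrightarrow> c \<in> {1, 4, 10, 49}) [1..146]" by code_simp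
  ultimately have cc: "c \<in> {1, 4, 10, 49}" using dvd unfolding list_all_iff by blast
  \<comment> \<open>Again the discriminant: 97, 721 and 18817 are not squares, while
    \<open>c = 1\<close> would give \<open>s + t = 3\<close>.\<close>
  have sq: "(int s - int t)\<^sup>2 = 8 * c\<^sup>2 - 8 * c + 1"
  proof -
    have "(int s - int t)\<^sup>2 = v\<^sup>2 - 4 * D"
      by (simp add: v_def D_def power2_eq_square algebra_simps)
    thus ?thesis by (simp add: v Dc power2_eq_square algebra_simps)
  qed
  have nsq: "z\<^sup>2 \<noteq> q" if "r\<^sup>2 < q" "q < (r + 1)\<^sup>2" "r > 0" for z q r :: int
    using that abs_le_square_iff[of z r] abs_le_square_iff[of "r + 1" z] by auto
  from cc consider "c = 1" | "c = 4" | "c = 10" | "c = 49" by blast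
  thus False
  proof cases
    case 1 thus False using v s2 t2 by (simp add: v_def)
  next
    case 2 thus False using sq nsq[of 9 97 "int s - int t"] by simp
  next
    case 3 thus False using sq nsq[of 26 721 "int s - int t"] by simp
  next
    case 4 thus False using sq nsq[of 137 18817 "int s - int t"] by simp
  qed
qed

text \<open>A common prime factor of \<open>s\<close> and \<open>t\<close> divides \<open>u\<close>,
  and therefore every term of \<open>eq\<close> except the 1 in the product
  \<open>(1 + s) * (1 + t)\<close>. In the applications \<open>eq\<close> expresses that the trace
  of \<open>M P\<close> is zero, split over the eigenspaces: \<open>k0\<close>, \<open>k1\<close>,
  \<open>k2\<close> are the traces of \<open>P\<close> on those of \<open>s + t\<close> and
  \<open>s + t \<plusminus> u\<close>.\<close>

lemma coprime_if_combination:
  fixes s t :: nat and u k0 k1 k2 :: int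
  assumes u: "int (s * t) dvd u\<^sup>2"
    and eq: "(1 + int s) * (1 + int t) + k0 * int (s + t) + k1 * (int (s + t) + u) + k2 * (int (s + t) - u) = 0"
  shows "coprime s t"
proof (rule ccontr)
  assume "\<not> coprime s t"
  then obtain p where p: "prime p" "p dvd s" "p dvd t"
    by (metis coprime_iff_gcd_eq_1 gcd_greatest_iff prime_factor_nat gcd_nat.bounded_iff)
  have ps: "int p dvd int s" "int p dvd int t" using p by simp_all
  have "int p dvd int (s * t)" using ps by simp
  hence "int p dvd u" using u p by (metis dvd_trans prime_dvd_power prime_nat_int_transfer)
  hence "int p dvd k0 * int (s + t) + k1 * (int (s + t) + u) + k2 * (int (s + t) - u) + (int s + int t + int s * int t)"
    using ps by simp
  moreover have "k0 * int (s + t) + k1 * (int (s + t) + u) + k2 * (int (s + t) - u) + (int s + int t + int s * int t) = - 1"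
    using eq by (simp add: algebra_simps)
  ultimately have "int p dvd - 1" by (simp only:)
  thus False using p by (simp add: prime_nat_iff)
qed

lemma algebraic_int_rat_eq:
  fixes x :: real
  assumes "algebraic_int x" "x \<in> \<rat>"
  obtains n :: int where "x = of_int n"
  using rational_algebraic_int_is_int[OF assms] by (auto elim: Ints_cases)

lemma sqrt_rational_square:
  fixes n :: nat
  assumes "sqrt n \<in> \<rat>"
  obtains m :: nat where "n = m\<^sup>2"
proof -
  have "algebraic_int (real n)" by (rule int_imp_algebraic_int) simp
  then obtain i :: int where i: "sqrt n = of_int i"
    using algebraic_int_rat_eq[OF algebraic_int_sqrt assms] by blast
  hence "real n = (of_int i)\<^sup>2" by (metis of_nat_0_le_iff real_sqrt_pow2)
  hence "int n = i\<^sup>2" by (metis of_int_eq_iff of_int_of_nat_eq of_int_power)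
  hence "int n = int ((nat \<bar>i\<bar>)\<^sup>2)" by simp
  hence "n = (nat \<bar>i\<bar>)\<^sup>2" by (simp only: of_nat_eq_iff)
  thus ?thesis using that by blast
qed

text \<open>Meant for multiplicity equations, which are linear in the square root \<eta>. They can
  be solved for \<eta> unless \<open>y = c\<close>, which would force \<open>v = x\<close>.\<close>

lemma rational_of_linear_relation:
  fixes \<eta> c x y v :: real
  assumes "c * (v + \<eta>) = y * (x + \<eta>)" "y \<noteq> 0" "v \<noteq> x" "c \<in> \<rat>" "v \<in> \<rat>" "x \<in> \<rat>" "y \<in> \<rat>"
  shows "\<eta> \<in> \<rat>"
proof -
  have "y \<noteq> c" using assms(1-3) by auto
  hence "\<eta> = (c * v - y * x) / (y - c)" using assms(1) by (simp add: field_simps)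
  thus ?thesis using assms by auto
qed

section \<open>The distance algebra of one type of elements\<close>

text \<open>If a matrix on points has entries \<open>h (d x y)\<close>, then its product with \<open>N N\<^sup>T\<close> has entries
  \<open>two_step k s t h (d x y)\<close> (\<open>sum_two_step\<close> and \<open>conv_S_delta\<close>).  Only even arguments up to \<open>k\<close>
  are meaningful.\<close>

definition two_step :: "nat \<Rightarrow> real \<Rightarrow> real \<Rightarrow> (nat \<Rightarrow> real) \<Rightarrow> nat \<Rightarrow> real" where
  "two_step k s t h m =
     (if m = 0 then (t + 1) * (h 0 + s * h 2)
      else if m = k then (t + 1) * (h (k - 2) + s * h k)
      else h (m - 2) + (s + t) * h m + s * t * h (m + 2))"

text \<open>The identity matrix as a function of the distance; iterating \<open>two_step\<close> on
  it yields the powers of \<open>N N\<^sup>T\<close>.\<close>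

definition delta :: "nat \<Rightarrow> real" where
  "delta m = (if m = 0 then 1 else 0)"

text \<open>To be applied with \<open>V\<close> the points and \<open>W\<close> the lines, and dually.\<close>

locale half_polygon =
  fixes V W :: "'a set" and A :: "('a \<times> 'a) set" and d :: "'a \<Rightarrow> 'a \<Rightarrow> nat" and k s t :: nat
  assumes finV: "finite V" and finW: "finite W" and VW: "V \<inter> W = {}" and V_ne: "V \<noteq> {}"
    and k_even: "even k" and k4: "k \<ge> 4"
    and nbr_V: "y \<in> V \<Longrightarrow> (y, z) \<in> A \<Longrightarrow> z \<in> W" and nbr_W: "y \<in> W \<Longrightarrow> (y, z) \<in> A \<Longrightarrow> z \<in> V"
    and card_V: "y \<in> V \<Longrightarrow> card {z. (y, z) \<in> A} = t + 1"
    and card_W: "y \<in> W \<Longrightarrow> card {z. (y, z) \<in> A} = s + 1"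
    and d_le: "x \<in> V \<union> W \<Longrightarrow> y \<in> V \<union> W \<Longrightarrow> d x y \<le> k"
    and d_0: "x \<in> V \<union> W \<Longrightarrow> y \<in> V \<union> W \<Longrightarrow> d x y = 0 \<longleftrightarrow> x = y"
    and d_sym: "d x y = d y x"
    and d_even: "x \<in> V \<Longrightarrow> y \<in> V \<union> W \<Longrightarrow> even (d x y) \<longleftrightarrow> y \<in> V"
    and d_step: "(y, z) \<in> A \<Longrightarrow> x \<in> V \<union> W \<Longrightarrow> d x z = Suc (d x y) \<or> d x y = Suc (d x z)"
    and pred: "x \<in> V \<union> W \<Longrightarrow> y \<in> V \<union> W \<Longrightarrow> 0 < d x y \<Longrightarrow> d x y < k \<Longrightarrow>
                 card {z. (y, z) \<in> A \<and> d x y = Suc (d x z)} = 1"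
begin

abbreviation "nbr y \<equiv> {z. (y, z) \<in> A}"

text \<open>An infinite set would have \<open>card\<close> equal to 0, but the prescribed sizes are
  positive.\<close>

lemma fin_nbr: "y \<in> V \<union> W \<Longrightarrow> finite (nbr y)"
  using card_V card_W by (metis UnE add_eq_0_iff_both_eq_0 card.infinite zero_neq_one)

text \<open>Exactly one neighbour of \<open>y\<close> is nearer to \<open>x\<close>; all others are
  one step farther away.\<close>

lemma sum_nbr_mid:
  fixes h :: "nat \<Rightarrow> real"
  assumes x: "x \<in> V \<union> W" and y: "y \<in> V \<union> W" and m: "0 < d x y" "d x y < k"
  shows "(\<Sum>z\<in>nbr y. h (d x z)) = h (d x y - 1) + (real (card (nbr y)) - 1) * h (d x y + 1)"
proof -
  let ?N = "{z. (y, z) \<in> A \<and> d x y = Suc (d x z)}"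
  have fin: "finite (nbr y)" by (rule fin_nbr[OF y])
  have sub: "?N \<subseteq> nbr y" by auto
  have "(\<Sum>z\<in>nbr y. h (d x z)) = (\<Sum>z\<in>nbr y - ?N. h (d x z)) + (\<Sum>z\<in>?N. h (d x z))"
    using fin sub by (rule sum.subset_diff[rotated])
  also have "(\<Sum>z\<in>?N. h (d x z)) = (\<Sum>z\<in>?N. h (d x y - 1))" 
  proof (intro sum.cong refl)
    fix z assume "z \<in> ?N"
    hence "d x z = d x y - 1" by simp
    thus "h (d x z) = h (d x y - 1)" by simp
  qed
  also have "\<dots> = h (d x y - 1)" by (simp only: sum_constant pred[OF x y m] of_nat_1 mult_1)
  also have "(\<Sum>z\<in>nbr y - ?N. h (d x z)) = (\<Sum>z\<in>nbr y - ?N. h (d x y + 1))"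

  proof (intro sum.cong refl)
    fix z assume "z \<in> nbr y - ?N"
    hence "d x z = d x y + 1" using d_step[OF _ x, of y z] by auto
    thus "h (d x z) = h (d x y + 1)" by simp
  qed
  also have "\<dots> = real (card (nbr y - ?N)) * h (d x y + 1)" by simp
  also have "real (card (nbr y - ?N)) = real (card (nbr y)) - 1"
    using card_mono[OF fin sub] card_Diff_subset[OF finite_subset[OF sub fin] sub] pred[OF x y m]
    by (simp add: of_nat_diff)
  finally show ?thesis by simp
qed

lemma sum_nbr_0:
  fixes h :: "nat \<Rightarrow> real"
  assumes x: "x \<in> V"
  shows "(\<Sum>z\<in>nbr x. h (d x z)) = (real t + 1) * h 1"
proof -
  have "d x z = 1" if "z \<in> nbr x" for z using d_step[of x z x] d_0[of x x] x that by auto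
  thus ?thesis using card_V[OF x] by simp
qed

lemma sum_nbr_k:
  fixes h :: "nat \<Rightarrow> real"
  assumes x: "x \<in> V" and y: "y \<in> V" "d x y = k"
  shows "(\<Sum>z\<in>nbr y. h (d x z)) = (real t + 1) * h (k - 1)"
proof -
  have "d x z = k - 1" if "z \<in> nbr y" for z
    using d_step[of y z x] d_le[of x z] nbr_V[of y z] x y that by auto
  thus ?thesis using card_V[OF y(1)] by simp
qed

text \<open>Elements of \<open>W\<close> are at odd distance from \<open>x\<close>, hence neither at
  0 nor at \<open>k\<close>, so one formula covers the inner sum. Only the outer sum meets the
  extreme distances.\<close>

lemma sum_two_step:
  fixes h :: "nat \<Rightarrow> real"
  assumes x: "x \<in> V" and y: "y \<in> V"
  shows "(\<Sum>w\<in>nbr y. \<Sum>z\<in>nbr w. h (d x z)) = two_step k s t h (d x y)"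
proof -
  let ?h = "\<lambda>m. h (m - 1) + real s * h (m + 1)"
  have dk: "d x y \<le> k" using d_le x y by auto
  have in1: "(\<Sum>z\<in>nbr w. h (d x z)) = ?h (d x w)" if "w \<in> nbr y" for w
  proof -
    have w: "w \<in> W" using nbr_V y that by auto
    have "odd (d x w)" using d_even[of x w] x w VW by auto
    hence "0 < d x w" "d x w < k" using d_le[of x w] x w k_even by (auto simp: odd_pos le_less)
    thus ?thesis using sum_nbr_mid[of x w h] card_W[OF w] x w by simp
  qed
  have "(\<Sum>w\<in>nbr y. \<Sum>z\<in>nbr w. h (d x z)) = (\<Sum>w\<in>nbr y. ?h (d x w))"
    using in1 by (intro sum.cong) auto
  also have "\<dots> = two_step k s t h (d x y)"
  proof -
    consider "d x y = 0" | "0 < d x y" "d x y < k" | "d x y = k" "d x y \<noteq> 0" using dk by linarith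
    thus ?thesis
    proof cases
      case 1
      hence "x = y" using d_0 x y by auto
      thus ?thesis using sum_nbr_0[OF x, of ?h] 1 by (simp add: two_step_def numeral_2_eq_2)
    next
      case 2
      have "even (d x y)" using d_even x y by auto
      hence "d x y \<ge> 2" using 2 by (auto elim!: evenE)
      then obtain m where m: "d x y = Suc (Suc m)" by (metis add_2_eq_Suc le_Suc_ex)
      show ?thesis
        using sum_nbr_mid[of x y ?h] 2 x y card_V[OF y] by (simp add: m two_step_def algebra_simps)
    next
      case 3
      obtain m where m: "k = Suc (Suc m)" using k4 that[of "k - 2"] by simp
      show ?thesis using sum_nbr_k[OF x y 3(1), of ?h] 3 by (simp add: two_step_def m)
    qed
  qed
  finally show ?thesis .
qed

text \<open>\<open>S\<close> is right multiplication by \<open>N N\<^sup>T\<close> on functions of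
  the distance; \<open>a\<close> is the row sum of that matrix, its eigenvalue on the all-one
  vector.\<close>

abbreviation "S \<equiv> two_step k (real s) (real t)"
abbreviation "a \<equiv> (real s + 1) * (real t + 1)"

lemma S_linear: "S (\<lambda>m. c * g m) = (\<lambda>m. c * S g m)" "S (\<lambda>m. g m + h m) = (\<lambda>m. S g m + S h m)"
  by (auto simp: fun_eq_iff two_step_def algebra_simps)

lemma S_const: "S (\<lambda>_. c) m = a * c"
  by (simp add: two_step_def algebra_simps)

lemma dV: "x \<in> V \<Longrightarrow> y \<in> V \<Longrightarrow> d x y \<le> k \<and> even (d x y)"
  using d_le d_even by auto

text \<open>\<open>S delta (d z y)\<close> counts the common neighbours of \<open>z\<close> and
  \<open>y\<close>, so the weighted sum runs over all paths of two steps from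
  \<open>y\<close>.\<close>

lemma sum_S_delta:
  fixes F :: "'a \<Rightarrow> real"
  assumes y: "y \<in> V"
  shows "(\<Sum>z\<in>V. F z * S delta (d z y)) = (\<Sum>w\<in>nbr y. \<Sum>z\<in>nbr w. F z)"
proof -
  have sub: "nbr w \<subseteq> V" if "w \<in> nbr y" for w using that nbr_V nbr_W y by auto
  have "(\<Sum>z\<in>V. F z * S delta (d z y)) = (\<Sum>z\<in>V. \<Sum>w\<in>nbr y. \<Sum>z'\<in>nbr w. if z' = z then F z else 0)"
  proof (intro sum.cong refl)
    fix z assume z: "z \<in> V"
    have "S delta (d z y) = (\<Sum>w\<in>nbr y. \<Sum>z'\<in>nbr w. delta (d z z'))"
      by (rule sum_two_step[OF z y, symmetric])
    also have "\<dots> = (\<Sum>w\<in>nbr y. \<Sum>z'\<in>nbr w. if z' = z then 1 else 0)"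
      using d_0 z sub by (intro sum.cong refl) (auto simp: subset_iff delta_def)
    finally show "F z * S delta (d z y) = (\<Sum>w\<in>nbr y. \<Sum>z'\<in>nbr w. if z' = z then F z else 0)"
      by (auto simp: sum_distrib_left intro!: sum.cong)
  qed
  also have "\<dots> = (\<Sum>w\<in>nbr y. \<Sum>z\<in>V. \<Sum>z'\<in>nbr w. if z' = z then F z else 0)"
    by (rule sum.swap)
  also have "\<dots> = (\<Sum>w\<in>nbr y. \<Sum>z'\<in>nbr w. \<Sum>z\<in>V. if z' = z then F z else 0)"
    by (rule sum.cong[OF refl], rule sum.swap)
  also have "\<dots> = (\<Sum>w\<in>nbr y. \<Sum>z\<in>nbr w. F z)"
    using sub finV by (intro sum.cong refl) (auto simp: subset_iff)
  finally show ?thesis .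
qed

lemma conv_S_delta:
  assumes "x \<in> V" "y \<in> V"
  shows "(\<Sum>z\<in>V. h (d x z) * S delta (d z y)) = S h (d x y)"
  using sum_S_delta[OF assms(2)] sum_two_step[OF assms] by simp

lemma sum_S_pow_delta:
  assumes "x \<in> V"
  shows "(\<Sum>y\<in>V. (S ^^ i) delta (d x y)) = a ^ i"
proof (induction i)
  case 0
  have "(\<Sum>y\<in>V. delta (d x y)) = (\<Sum>y\<in>V. if y = x then 1 else 0)"
    using assms d_0 by (intro sum.cong) (auto simp: delta_def)
  thus ?case using finV assms by simp
next
  case (Suc i)
  have "(\<Sum>y\<in>V. (S ^^ Suc i) delta (d x y)) = (\<Sum>y\<in>V. \<Sum>z\<in>V. (S ^^ i) delta (d x z) * S delta (d z y))"
    using assms by (intro sum.cong) (auto simp: conv_S_delta)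
  also have "\<dots> = (\<Sum>z\<in>V. (S ^^ i) delta (d x z) * (\<Sum>y\<in>V. S delta (d z y)))"
    by (subst sum.swap) (simp add: sum_distrib_left)
  also have "\<dots> = (\<Sum>z\<in>V. (S ^^ i) delta (d x z) * a)"
  proof (intro sum.cong refl arg_cong[where f = "\<lambda>q. _ * q"])
    fix z assume z: "z \<in> V"
    \<comment> \<open>\<open>conv_S_delta\<close> sums over the first argument; the symmetry of
      \<open>d\<close> turns the row sum into such a sum.\<close>
    have "(\<Sum>y\<in>V. S delta (d z y)) = (\<Sum>y\<in>V. 1 * S delta (d y z))"
      by (intro sum.cong) (auto simp: d_sym[of z])
    also have "\<dots> = a" using conv_S_delta[OF z z, of "\<lambda>_. 1"] by (simp add: S_const)
    finally show "(\<Sum>y\<in>V. S delta (d z y)) = a" .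
  qed
  also have "\<dots> = (\<Sum>z\<in>V. (S ^^ i) delta (d x z)) * a" by (rule sum_distrib_right[symmetric])
  also have "\<dots> = a ^ Suc i" by (simp only: Suc.IH power_Suc2)
  finally show ?case .
qed

end

text \<open>In terms of matrices, \<open>g\<close> stands for \<open>f(M)\<close> with \<open>f(x) = c1 x + c2 x\<^sup>2 + c3 x\<^sup>3\<close>, and
  \<open>g_eigen\<close> says \<open>f(M) (M - \<mu>) = (t + 1) J\<close> with \<open>J\<close> the all-one matrix.  Subtracting \<open>\<kappa> J\<close> leaves
  \<open>f(\<mu>)\<close> times the projection onto the eigenspace of \<open>\<mu>\<close>.\<close>

locale half_polygon_eigen = half_polygon +
  fixes g :: "nat \<Rightarrow> real" and c1 c2 c3 \<mu> :: real
  assumes g_def: "g m = c1 * S delta m + c2 * S (S delta) m + c3 * S (S (S delta)) m"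
    and g_eigen: "m \<le> k \<Longrightarrow> even m \<Longrightarrow> S g m = \<mu> * g m + (t + 1)"
    and mu_a: "\<mu> \<noteq> a"
begin

definition "f x = c1 * x + c2 * x ^ 2 + c3 * x ^ 3"
definition "\<kappa> = (t + 1) / (a - \<mu>)"
definition "h m = g m - \<kappa>"

lemma S_h:
  assumes "m \<le> k" "even m" shows "S h m = \<mu> * h m"
proof -
  have "h = (\<lambda>m. g m + - \<kappa>)" by (simp add: fun_eq_iff h_def)
  hence "S h m = S g m + S (\<lambda>_. - \<kappa>) m" by (simp only: S_linear)
  also have "\<dots> = \<mu> * g m + (t + 1) - a * \<kappa>"
    using g_eigen[OF assms] by (simp only: S_const)
  also have "a * \<kappa> = (t + 1) + \<mu> * \<kappa>" using mu_a by (simp add: \<kappa>_def field_simps)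
  finally show ?thesis unfolding h_def[of m] by (simp add: right_diff_distrib)
qed

lemma conv_h_S_pow:
  assumes "x \<in> V" "y \<in> V"
  shows "(\<Sum>z\<in>V. h (d x z) * (S ^^ i) delta (d z y)) = \<mu> ^ i * h (d x y)"
  using assms(2)
proof (induction i arbitrary: y)
  case 0
  have "(\<Sum>z\<in>V. h (d x z) * delta (d z y)) = (\<Sum>z\<in>V. if z = y then h (d x y) else 0)"
    using 0 d_0 by (intro sum.cong) (auto simp: delta_def)
  thus ?case using finV 0 by simp
next
  case (Suc i)
  have "(\<Sum>z\<in>V. h (d x z) * (S ^^ Suc i) delta (d z y))
      = (\<Sum>z\<in>V. h (d x z) * (\<Sum>w\<in>V. (S ^^ i) delta (d z w) * S delta (d w y)))"
    using Suc.prems by (intro sum.cong) (auto simp: conv_S_delta)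
  also have "\<dots> = (\<Sum>w\<in>V. (\<Sum>z\<in>V. h (d x z) * (S ^^ i) delta (d z w)) * S delta (d w y))"
    by (simp add: sum_distrib_left sum_distrib_right mult.assoc) (rule sum.swap)
  also have "\<dots> = \<mu> ^ i * (\<Sum>w\<in>V. h (d x w) * S delta (d w y))"
    using Suc.IH by (simp add: sum_distrib_left mult.assoc)
  also have "\<dots> = \<mu> ^ i * S h (d x y)" using conv_S_delta[OF assms(1) Suc.prems] by simp
  finally show ?case using S_h dV[OF assms(1) Suc.prems] by simp
qed

lemma sum_g: "x \<in> V \<Longrightarrow> (\<Sum>y\<in>V. g (d x y)) = f a"
  using sum_S_pow_delta[of x 1] sum_S_pow_delta[of x 2] sum_S_pow_delta[of x 3]
  by (simp add: g_def f_def sum.distrib numeral_2_eq_2 numeral_3_eq_3 flip: sum_distrib_left)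

text \<open>Eigenvectors for different eigenvalues are orthogonal: evaluating the double sum in two
  ways gives \<mu> times and \<open>a\<close> times the row sum.\<close>

lemma sum_h:
  assumes x: "x \<in> V" shows "(\<Sum>y\<in>V. h (d x y)) = 0"
proof -
  have "\<mu> * (\<Sum>y\<in>V. h (d x y)) = (\<Sum>y\<in>V. \<Sum>z\<in>V. h (d x z) * S delta (d z y))"
    using conv_h_S_pow[OF x, of _ 1] by (simp add: sum_distrib_left)
  also have "\<dots> = (\<Sum>z\<in>V. h (d x z) * (\<Sum>y\<in>V. S delta (d z y)))"
    by (subst sum.swap) (simp add: sum_distrib_left)
  also have "\<dots> = (\<Sum>z\<in>V. h (d x z)) * a"
    using sum_S_pow_delta[of _ 1] by (simp add: sum_distrib_right)
  finally show ?thesis using mu_a by (simp add: mult.commute)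
qed

text \<open>Compares row sums of \<open>g = h + \<kappa>\<close>. This replaces a count of the
  elements by distance.\<close>

lemma card_V_\<kappa>: "real (card V) * \<kappa> = f a"
proof -
  obtain x where x: "x \<in> V" using V_ne by auto
  show ?thesis using sum_g[OF x] sum_h[OF x] by (simp add: h_def sum_subtractf)
qed

text \<open>One factor is written as \<open>f(M) - \<kappa> J\<close>: the power terms act on
  \<open>h\<close> as \<open>f \<mu>\<close>, and the all-one matrix kills it. Hence
  \<open>h / f \<mu>\<close> is idempotent.\<close>

lemma conv_h_h:
  assumes "x \<in> V" "y \<in> V"
  shows "(\<Sum>z\<in>V. h (d x z) * h (d z y)) = f \<mu> * h (d x y)"
proof -
  have "(\<Sum>z\<in>V. h (d x z) * h (d z y))
     = c1 * (\<Sum>z\<in>V. h (d x z) * (S ^^ 1) delta (d z y)) + c2 * (\<Sum>z\<in>V. h (d x z) * (S ^^ 2) delta (d z y))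
     + c3 * (\<Sum>z\<in>V. h (d x z) * (S ^^ 3) delta (d z y)) - \<kappa> * (\<Sum>z\<in>V. h (d x z))"
    by (simp add: h_def[of "d _ y"] g_def algebra_simps sum.distrib sum_subtractf sum_distrib_left
        numeral_2_eq_2 numeral_3_eq_3)
  also have "\<dots> = f \<mu> * h (d x y)"
    using assms by (simp only: conv_h_S_pow sum_h) (simp add: f_def algebra_simps)
  finally show ?thesis .
qed

section \<open>Projections twisted by isometries\<close>

definition enum :: "nat \<Rightarrow> 'a" where
  "enum = (SOME e. bij_betw e {..<card V} V)"

lemma enum: "bij_betw enum {..<card V} V"
  unfolding enum_def using ex_bij_betw_nat_finite[OF finV] by (metis atLeast0LessThan someI)

lemma enum_in: "i < card V \<Longrightarrow> enum i \<in> V"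
  using enum unfolding bij_betw_def by auto

text \<open>The product of the projection \<open>h / f \<mu>\<close> with a permutation matrix, over
  the complex numbers so that a triangular form exists.\<close>

definition twisted :: "('a \<Rightarrow> 'a) \<Rightarrow> complex mat" where
  "twisted \<phi> = mat (card V) (card V) (\<lambda>(i, j). of_real (h (d (enum i) (\<phi> (enum j))) / f \<mu>))"

lemma twisted_carrier: "twisted \<phi> \<in> carrier_mat (card V) (card V)"
  by (simp add: twisted_def)

lemma mat_trace_twisted: "mat_trace (twisted \<phi>) = of_real ((\<Sum>x\<in>V. h (d x (\<phi> x))) / f \<mu>)"
proof -
  have "mat_trace (twisted \<phi>) = of_real (\<Sum>i<card V. h (d (enum i) (\<phi> (enum i))) / f \<mu>)"
    by (simp add: mat_trace_def twisted_def)
  also have "(\<Sum>i<card V. h (d (enum i) (\<phi> (enum i))) / f \<mu>) = (\<Sum>x\<in>V. h (d x (\<phi> x)) / f \<mu>)"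
    by (rule sum.reindex_bij_betw[OF enum])
  finally show ?thesis by (simp add: sum_divide_distrib)
qed

text \<open>The projection is idempotent and commutes with isometries; the latter is the
  substitution of \<open>z\<close> for \<open>\<phi> z\<close> in the sum.\<close>

lemma twisted_mult:
  assumes f: "f \<mu> \<noteq> 0" and \<phi>: "\<phi> permutes V" and \<psi>: "\<psi> permutes V"
    and iso: "\<And>x y. x \<in> V \<Longrightarrow> y \<in> V \<Longrightarrow> d (\<phi> x) (\<phi> y) = d x y"
  shows "twisted \<phi> * twisted \<psi> = twisted (\<phi> \<circ> \<psi>)"
proof (rule eq_matI)
  fix i j assume "i < dim_row (twisted (\<phi> \<circ> \<psi>))" "j < dim_col (twisted (\<phi> \<circ> \<psi>))"
  hence ij: "i < card V" "j < card V" by (auto simp: twisted_def)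
  define x y where "x = enum i" and "y = \<psi> (enum j)"
  have xy: "x \<in> V" "y \<in> V" using enum_in ij permutes_in_image[OF \<psi>] by (auto simp: x_def y_def)
  hence \<phi>y: "\<phi> y \<in> V" using permutes_in_image[OF \<phi>] by auto
  have "(twisted \<phi> * twisted \<psi>) $$ (i, j)
     = of_real (\<Sum>l<card V. h (d x (\<phi> (enum l))) / f \<mu> * (h (d (enum l) y) / f \<mu>))"
    using ij by (simp add: twisted_def scalar_prod_def atLeast0LessThan x_def y_def)
  also have "(\<Sum>l<card V. h (d x (\<phi> (enum l))) / f \<mu> * (h (d (enum l) y) / f \<mu>))
     = (\<Sum>z\<in>V. h (d x (\<phi> z)) / f \<mu> * (h (d z y) / f \<mu>))"
    by (rule sum.reindex_bij_betw[OF enum])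
  also have "\<dots> = (\<Sum>z\<in>V. h (d x (\<phi> z)) / f \<mu> * (h (d (\<phi> z) (\<phi> y)) / f \<mu>))"
    using iso xy by simp
  also have "\<dots> = (\<Sum>z\<in>V. h (d x z) / f \<mu> * (h (d z (\<phi> y)) / f \<mu>))"
    by (rule sum.reindex_bij_betw[OF permutes_imp_bij[OF \<phi>]])
  also have "\<dots> = (\<Sum>z\<in>V. h (d x z) * h (d z (\<phi> y))) / (f \<mu> * f \<mu>)"
    by (simp add: sum_divide_distrib)
  also have "\<dots> = h (d x (\<phi> y)) / f \<mu>" using conv_h_h[OF xy(1) \<phi>y] f by simp
  finally show "(twisted \<phi> * twisted \<psi>) $$ (i, j) = twisted (\<phi> \<circ> \<psi>) $$ (i, j)"
    using ij by (simp add: twisted_def x_def y_def)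
qed (auto simp: twisted_def)

theorem algebraic_int_trace:
  assumes f: "f \<mu> \<noteq> 0" and \<phi>: "\<phi> permutes V"
    and iso: "\<And>x y. x \<in> V \<Longrightarrow> y \<in> V \<Longrightarrow> d (\<phi> x) (\<phi> y) = d x y"
  shows "algebraic_int (((\<Sum>x\<in>V. g (d x (\<phi> x))) - f a) / f \<mu>)"
proof -
  have "permutation \<phi>" using \<phi> finV unfolding permutation_permutes by blast
  then obtain m where m: "\<phi> ^^ m = id" "m > 0" using permutation_is_nilpotent by blast
  \<comment> \<open>Exponents start at 1, since the zeroth power is the identity matrix whereas
    \<open>twisted id\<close> is the projection.\<close>
  have pow: "twisted \<phi> ^\<^sub>m Suc i = twisted (\<phi> ^^ Suc i)" for i
  proof (induction i)
    case 0
    show ?case using left_mult_one_mat[OF twisted_carrier] by (simp add: twisted_def)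
  next
    case (Suc i)
    have isoi: "d ((\<phi> ^^ i) x) ((\<phi> ^^ i) y) = d x y \<and> (\<phi> ^^ i) x \<in> V \<and> (\<phi> ^^ i) y \<in> V"
      if "x \<in> V" "y \<in> V" for x y i
      by (induction i) (use that iso permutes_in_image[OF \<phi>] in auto)
    have pp: "(\<phi> ^^ i) permutes V" for i
    proof (induction i)
      case 0 show ?case by (simp only: funpow_0 funpow.simps(1) permutes_id)
    next
      case (Suc i) thus ?case by (simp only: funpow.simps(2) permutes_compose[OF _ \<phi>])
    qed
    have "twisted \<phi> ^\<^sub>m Suc (Suc i) = twisted (\<phi> ^^ Suc i) * twisted \<phi>"
      by (subst pow_mat.simps(2)) (simp only: Suc.IH)
    also have "\<dots> = twisted (\<phi> ^^ Suc i \<circ> \<phi>)"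
      by (rule twisted_mult[OF f pp \<phi>]) (use isoi in blast)
    finally show ?case by (simp only: funpow_Suc_right)
  qed
  have "twisted \<phi> ^\<^sub>m Suc m = twisted \<phi>" unfolding pow by (simp add: m)
  hence "algebraic_int (mat_trace (twisted \<phi>))"
    using algebraic_int_mat_trace_periodic[OF twisted_carrier] m by blast
  hence "algebraic_int ((\<Sum>x\<in>V. h (d x (\<phi> x))) / f \<mu>)" by (simp only: mat_trace_twisted algebraic_int_of_real_iff)
  moreover have "(\<Sum>x\<in>V. h (d x (\<phi> x))) = (\<Sum>x\<in>V. g (d x (\<phi> x))) - f a"
    using card_V_\<kappa> by (simp add: h_def sum_subtractf)
  ultimately show ?thesis by simp
qed

text \<open>The number is the trace \<open>card V * h 0 / f \<mu>\<close> of the projection, the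
  multiplicity of \<mu>, with \<open>card V\<close> eliminated by
  \<open>card_V_\<kappa>\<close>.\<close>

theorem multiplicity_nat:
  assumes f: "f \<mu> \<noteq> 0"
  shows "f a * (g 0 * (a - \<mu>) / (t + 1) - 1) / f \<mu> \<in> \<nat>"
proof -
  have id: "id permutes V" by (rule permutes_id)
  have "mat_trace (twisted id) \<in> \<nat>"
    using twisted_mult[OF f id id] by (intro mat_trace_idempotent[OF twisted_carrier]) simp
  moreover have "(\<Sum>x\<in>V. h (d x (id x))) = real (card V) * h 0"
  proof -
    have "h (d x (id x)) = h 0" if "x \<in> V" for x using d_0[of x x] that by simp
    thus ?thesis by simp
  qed
  moreover have "real (card V) * h 0 = f a * (g 0 * (a - \<mu>) / (t + 1) - 1)"
  proof -
    have nz: "\<kappa> \<noteq> 0" and inv: "(a - \<mu>) / (t + 1) = 1 / \<kappa>" using mu_a by (auto simp: \<kappa>_def)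
    have "real (card V) * h 0 = real (card V) * \<kappa> * (g 0 * (1 / \<kappa>) - 1)"
      using nz by (simp add: h_def right_diff_distrib)
    thus ?thesis by (simp only: card_V_\<kappa> flip: inv) (simp only: times_divide_eq_right)
  qed
  ultimately have "complex_of_real (f a * (g 0 * (a - \<mu>) / (t + 1) - 1) / f \<mu>) \<in> \<nat>"
    by (simp only: mat_trace_twisted)
  then obtain n :: nat where "complex_of_real (f a * (g 0 * (a - \<mu>) / (t + 1) - 1) / f \<mu>) = of_real (real n)"
    by (auto elim!: Nats_cases)
  hence "f a * (g 0 * (a - \<mu>) / (t + 1) - 1) / f \<mu> = real n" by (simp only: of_real_eq_iff)
  thus ?thesis by (simp only: of_nat_in_Nats)
qed

end

section \<open>Eigenvalues of quadrangles, hexagons and octagons\<close>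

lemma even_le_cases:
  fixes m :: nat
  assumes "even m"
  shows "m \<le> 4 \<Longrightarrow> m = 0 \<or> m = 2 \<or> m = 4" "m \<le> 6 \<Longrightarrow> m = 0 \<or> m = 2 \<or> m = 4 \<or> m = 6"
    "m \<le> 8 \<Longrightarrow> m = 0 \<or> m = 2 \<or> m = 4 \<or> m = 6 \<or> m = 8"
  using assms by presburger+

context half_polygon begin

abbreviation "v \<equiv> real s + real t"
abbreviation "D \<equiv> real s * real t"

text \<open>The trace of the \<open>i\<close>-th power of \<open>N N\<^sup>T\<close> times the
  permutation matrix of \<phi>.\<close>

definition T :: "nat \<Rightarrow> ('a \<Rightarrow> 'a) \<Rightarrow> real" where
  "T i \<phi> = (\<Sum>x\<in>V. (S ^^ i) delta (d x (\<phi> x)))"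

lemma S_Ints: "(\<And>m. h m \<in> \<int>) \<Longrightarrow> S h m \<in> \<int>"
  by (auto simp: two_step_def intro!: Ints_add Ints_mult)

lemma T_Ints: "T i \<phi> \<in> \<int>"
proof -
  have "(S ^^ i) delta m \<in> \<int>" for m
  proof (induction i arbitrary: m)
    case (Suc i) thus ?case using S_Ints[of "(S ^^ i) delta"] by simp
  qed (simp add: delta_def)
  thus ?thesis unfolding T_def by (rule Ints_sum)
qed

lemma S_delta_ge: "m \<ge> 4 \<Longrightarrow> S delta m = 0"
  using k4 by (auto simp: two_step_def delta_def)

lemma T1_eq_0:
  assumes "\<And>x. x \<in> V \<Longrightarrow> d x (\<phi> x) \<ge> 4" shows "T 1 \<phi> = 0"
  unfolding T_def using assms by (simp add: S_delta_ge)

text \<open>The square of \<open>N N\<^sup>T\<close> reaches distance 4 only, just as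
  \<open>N N\<^sup>T\<close> itself reaches distance 2 in \<open>T1_eq_0\<close>.\<close>

lemma T2_eq_0:
  assumes "\<And>x. x \<in> V \<Longrightarrow> d x (\<phi> x) \<ge> 6" shows "T 2 \<phi> = 0"
proof -
  have "S (S delta) m = 0" if "m \<ge> 6" for m
    using that by (auto simp: two_step_def[of k s t "S delta"] S_delta_ge)
  thus ?thesis unfolding T_def using assms by (simp add: numeral_2_eq_2)
qed

end

context half_polygon_eigen begin

lemma algebraic_int_T:
  assumes "f \<mu> \<noteq> 0" and "\<phi> permutes V"
    and "\<And>x y. x \<in> V \<Longrightarrow> y \<in> V \<Longrightarrow> d (\<phi> x) (\<phi> y) = d x y"
  shows "algebraic_int ((c1 * T 1 \<phi> + c2 * T 2 \<phi> + c3 * T 3 \<phi> - f a) / f \<mu>)"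
proof -
  have "(\<Sum>x\<in>V. g (d x (\<phi> x))) = c1 * T 1 \<phi> + c2 * T 2 \<phi> + c3 * T 3 \<phi>"
    by (simp add: T_def g_def sum.distrib sum_distrib_left numeral_2_eq_2 numeral_3_eq_3)
  thus ?thesis using algebraic_int_trace[OF assms] by simp
qed

end

context half_polygon begin

text \<open>Equality would mean \<open>\<eta> = 1 + D\<close>, whose square exceeds
  \<open>2 * D\<close>.\<close>

lemma mu_neq:
  assumes "\<eta>\<^sup>2 = 0 \<or> \<eta>\<^sup>2 = D \<or> \<eta>\<^sup>2 = 2 * D"
  shows "v + \<eta> \<noteq> a"
proof
  assume "v + \<eta> = a"
  hence "\<eta> = 1 + D" by (simp add: algebra_simps)
  hence "\<eta>\<^sup>2 = 1 + 2 * D + D\<^sup>2" by (simp add: power2_eq_square algebra_simps)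
  moreover have "D \<ge> 0" "D\<^sup>2 \<ge> 0" by simp_all
  ultimately show False using assms by linarith
qed

lemma S_values:
  fixes h :: "nat \<Rightarrow> real"
  shows "S h 0 = (t + 1) * (h 0 + s * h 2)"
  "4 < k \<Longrightarrow> S h 4 = h 2 + v * h 4 + D * h 6"
  "6 < k \<Longrightarrow> S h 6 = h 4 + v * h 6 + D * h 8"
  "2 < k \<Longrightarrow> S h 2 = h 0 + v * h 2 + D * h 4"
  "S h k = (t + 1) * (h (k - 2) + s * h k)"
  using k4 by (auto simp: two_step_def algebra_simps)

lemma delta_values: "delta 0 = 1" "delta 2 = 0" "delta 4 = 0" "delta 6 = 0" "delta 8 = 0"
  by (simp_all add: delta_def)

text \<open>Besides \<open>a\<close> and \<open>v\<close> only the eigenvalue 0 can occur, and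
  \<open>f(x) = x\<close> vanishes there.\<close>

lemma quadrangle_eigen:
  assumes "k = 4"
  shows "half_polygon_eigen V W A d k s t (S delta) 1 0 0 v"
proof unfold_locales
  fix m assume "m \<le> k" "even m"
  hence "m = 0 \<or> m = 2 \<or> m = 4" using assms even_le_cases by blast
  moreover note S_values[of delta] S_values(1,4,5)[of "S delta"]
  ultimately show "S (S delta) m = v * S delta m + real (t + 1)"
    using assms by (elim disjE) (simp_all add: delta_values algebra_simps)
next
  show "v \<noteq> a" using mu_neq[of 0] by simp
qed simp

text \<open>Here \<open>f(x) = x (x - (v - \<eta>))\<close> vanishes at the remaining eigenvalues 0
  and \<open>v - \<eta>\<close>. Either sign of the root \<eta> is allowed.\<close>

lemma hexagon_eigen:
  assumes "k = 6" and \<eta>: "\<eta>\<^sup>2 = D"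
  shows "half_polygon_eigen V W A d k s t (\<lambda>m. (\<eta> - v) * S delta m + S (S delta) m) (\<eta> - v) 1 0 (v + \<eta>)"
    (is "half_polygon_eigen _ _ _ _ _ _ _ ?g _ _ _ _")
proof unfold_locales
  note S1 = S_values[of delta, simplified assms(1) delta_values, simplified]
  note S2 = S_values[of "S delta", simplified assms(1) delta_values, simplified]
  have g: "?g 0 = (t + 1) * (1 + \<eta>)" "?g 2 = \<eta> + t + 1" "?g 4 = 1" "?g 6 = 0"
    unfolding assms(1) S2 S1 by (simp_all add: delta_values algebra_simps)
  fix m assume "m \<le> k" "even m"
  hence "m = 0 \<or> m = 2 \<or> m = 4 \<or> m = 6" using assms even_le_cases by blast
  thus "S ?g m = (v + \<eta>) * ?g m + real (t + 1)"
  proof (elim disjE)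
    assume m: "m = 0"
    have "S ?g 0 - ((v + \<eta>) * ?g 0 + real (t + 1)) = (t + 1) * (D - \<eta>\<^sup>2)"
      unfolding S_values(1)[of ?g] g by (simp add: power2_eq_square algebra_simps)
    thus ?thesis using \<eta> m by simp
  next
    assume m: "m = 2"
    have "S ?g 2 - ((v + \<eta>) * ?g 2 + real (t + 1)) = D - \<eta>\<^sup>2"
      using S_values(4)[of ?g] assms(1) unfolding g by (simp add: power2_eq_square algebra_simps)
    thus ?thesis using \<eta> m by simp
  next
    assume m: "m = 4"
    have "S ?g 4 = (v + \<eta>) * ?g 4 + real (t + 1)"
      using S_values(2)[of ?g] assms(1) unfolding g by (simp add: algebra_simps)
    thus ?thesis using m by simp
  next
    assume m: "m = 6"
    have "S ?g 6 = (t + 1) * (?g 4 + s * ?g 6)" using S_values(5)[of ?g] assms(1) by simp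
    hence "S ?g 6 = (v + \<eta>) * ?g 6 + real (t + 1)" unfolding g by simp
    thus ?thesis using m by simp
  qed
next
  show "v + \<eta> \<noteq> a" using mu_neq \<eta> by simp
qed simp

text \<open>With \<open>y = x - v\<close>, the eigenvalues other than \<open>a\<close> and 0 are the
  roots of \<open>y (y\<^sup>2 - 2 D)\<close>. The coefficients come from
  \<open>f(x) = x (y\<^sup>2 + \<eta> y + \<eta>\<^sup>2 - 2 D)\<close>, that is, \<open>x\<close>
  times this cubic divided by \<open>y - \<eta>\<close>.\<close>

lemma octagon_eigen:
  assumes "k = 8" and \<eta>: "\<eta> * (\<eta>\<^sup>2 - 2 * D) = 0"
  shows "half_polygon_eigen V W A d k s t
    (\<lambda>m. (v\<^sup>2 - \<eta> * v + \<eta>\<^sup>2 - 2 * D) * S delta m + (\<eta> - 2 * v) * S (S delta) m + S (S (S delta)) m)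
    (v\<^sup>2 - \<eta> * v + \<eta>\<^sup>2 - 2 * D) (\<eta> - 2 * v) 1 (v + \<eta>)"
    (is "half_polygon_eigen _ _ _ _ _ _ _ ?g _ _ _ _")
proof unfold_locales
  note S1 = S_values[of delta, simplified assms(1) delta_values, simplified]
  note S2 = S_values[of "S delta", simplified assms(1) delta_values, simplified]
  note S3 = S_values[of "S (S delta)", simplified assms(1) delta_values, simplified]
  have g: "?g 0 = (t + 1) * (1 + \<eta> + \<eta>\<^sup>2 - D)" "?g 2 = (t + 1) * (1 + \<eta>) + \<eta>\<^sup>2 - D"
    "?g 4 = t + 1 + \<eta>" "?g 6 = 1" "?g 8 = 0"
    unfolding assms(1) S3 S2 S1 by (simp_all add: delta_values power2_eq_square algebra_simps)
  fix m assume "m \<le> k" "even m"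
  hence "m = 0 \<or> m = 2 \<or> m = 4 \<or> m = 6 \<or> m = 8" using assms even_le_cases by blast
  thus "S ?g m = (v + \<eta>) * ?g m + real (t + 1)"
  proof (elim disjE)
    assume m: "m = 0"
    have "S ?g 0 - ((v + \<eta>) * ?g 0 + real (t + 1)) = - (t + 1) * (\<eta> * (\<eta>\<^sup>2 - 2 * D))"
      unfolding S_values(1)[of ?g] g by (simp add: power2_eq_square algebra_simps)
    thus ?thesis using \<eta> m by simp
  next
    assume m: "m = 2"
    have "S ?g 2 - ((v + \<eta>) * ?g 2 + real (t + 1)) = - (\<eta> * (\<eta>\<^sup>2 - 2 * D))"
      using S_values(4)[of ?g] assms(1) unfolding g by (simp add: power2_eq_square algebra_simps)
    thus ?thesis using \<eta> m by simp
  next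
    assume m: "m = 4"
    have "S ?g 4 = (v + \<eta>) * ?g 4 + real (t + 1)"
      using S_values(2)[of ?g] assms(1) unfolding g by (simp add: power2_eq_square algebra_simps)
    thus ?thesis using m by simp
  next
    assume m: "m = 6"
    have "S ?g 6 = (v + \<eta>) * ?g 6 + real (t + 1)"
      using S_values(3)[of ?g] assms(1) unfolding g by (simp add: algebra_simps)
    thus ?thesis using m by simp
  next
    assume m: "m = 8"
    have "S ?g 8 = (t + 1) * (?g 6 + s * ?g 8)" using S_values(5)[of ?g] assms(1) by simp
    hence "S ?g 8 = (v + \<eta>) * ?g 8 + real (t + 1)" unfolding g by simp
    thus ?thesis using m by simp
  qed
next
  have "\<eta>\<^sup>2 = 0 \<or> \<eta>\<^sup>2 = 2 * D" using \<eta> by auto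
  thus "v + \<eta> \<noteq> a" using mu_neq by blast
qed simp

end

section \<open>Displacements of isometries\<close>

context half_polygon begin

definition isometry :: "('a \<Rightarrow> 'a) \<Rightarrow> bool" where
  "isometry \<phi> \<longleftrightarrow> \<phi> permutes V \<and> (\<forall>x\<in>V. \<forall>y\<in>V. d (\<phi> x) (\<phi> y) = d x y)"

lemma a_eq: "a = 1 + v + D"
  by (simp add: algebra_simps)

text \<open>Since \<open>T 1 \<phi>\<close> vanishes, the trace at the eigenvalue \<open>v\<close>
  is \<open>- a / v\<close>; being rational, it is an integer.\<close>

theorem quadrangle_coprime:
  assumes k: "k = 4" and s: "s > 0" and \<phi>: "isometry \<phi>" and far: "\<And>x. x \<in> V \<Longrightarrow> d x (\<phi> x) \<ge> 4"
  shows "coprime s t"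
proof -
  interpret Q: half_polygon_eigen V W A d k s t "S delta" 1 0 0 v by (rule quadrangle_eigen[OF k])
  have f: "Q.f x = x" for x by (simp add: Q.f_def)
  have v: "v > 0" using s by simp
  have "algebraic_int ((0 - a) / v)"
    using Q.algebraic_int_T[of \<phi>] \<phi> v T1_eq_0[OF far] unfolding isometry_def f by simp
  moreover have "(0 - a) / v \<in> \<rat>" by (intro Rats_divide Rats_diff Rats_mult Rats_add) auto
  ultimately obtain n :: int where n: "(0 - a) / v = of_int n" using algebraic_int_rat_eq by blast
  hence "a + of_int n * v = 0" using v by (simp add: field_simps)
  hence "real_of_int ((1 + int s) * (1 + int t) + n * int (s + t)) = real_of_int 0" by (simp add: algebra_simps)
  hence "(1 + int s) * (1 + int t) + n * int (s + t) = 0" by (simp only: of_int_eq_iff)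
  thus ?thesis by (intro coprime_if_combination[of s t 0 n 0 0]) auto
qed

section \<open>Hexagons\<close>

lemma hexagon_f_values:
  fixes \<eta> :: real
  assumes "\<eta>\<^sup>2 = D"
  shows "(\<eta> - v) * (v + \<eta>) + (v + \<eta>)\<^sup>2 = (v + \<eta>) * (2 * \<eta>)" "(\<eta> - v) * a + a\<^sup>2 = a * (1 + D + \<eta>)"
    "(1 + \<eta>) * (a - (v + \<eta>)) - 1 = \<eta> * D"
  using assms unfolding a_eq by (simp_all add: power2_eq_square algebra_simps)

text \<open>\<open>K\<close> is the trace of \<phi> on the eigenspace of \<open>v + \<eta>\<close>;
  for rational \<eta> it is rational, so the algebraic integer is an integer.\<close>

lemma hexagon_trace:
  assumes k: "k = 6" and \<eta>: "\<eta>\<^sup>2 = D" "\<eta> \<in> \<rat>" "\<eta> \<noteq> 0" "v + \<eta> \<noteq> 0" and \<phi>: "isometry \<phi>"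
  obtains K :: int where "of_int K * ((v + \<eta>) * (2 * \<eta>)) = T 2 \<phi> + (\<eta> - v) * T 1 \<phi> - a * (1 + D + \<eta>)"
proof -
  interpret H: half_polygon_eigen V W A d k s t "\<lambda>m. (\<eta> - v) * S delta m + S (S delta) m"
    "\<eta> - v" 1 0 "v + \<eta>" by (rule hexagon_eigen[OF k \<eta>(1)])
  note f = hexagon_f_values[OF \<eta>(1)]
  have f\<mu>: "H.f (v + \<eta>) = (v + \<eta>) * (2 * \<eta>)" and fa: "H.f a = a * (1 + D + \<eta>)"
    unfolding H.f_def using f by simp_all
  let ?K = "((\<eta> - v) * T 1 \<phi> + T 2 \<phi> - a * (1 + D + \<eta>)) / ((v + \<eta>) * (2 * \<eta>))"
  have nz: "(v + \<eta>) * (2 * \<eta>) \<noteq> 0" using \<eta> by simp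
  have "algebraic_int ?K"
    using H.algebraic_int_T[of \<phi>] \<phi> nz unfolding isometry_def f\<mu> fa by simp
  moreover have "?K \<in> \<rat>"
    using \<eta>(2) T_Ints[of 1 \<phi>] T_Ints[of 2 \<phi>] Ints_subset_Rats
    by (intro Rats_divide Rats_diff Rats_mult Rats_add) auto
  ultimately obtain K :: int where "?K = of_int K" using algebraic_int_rat_eq by blast
  hence "of_int K * ((v + \<eta>) * (2 * \<eta>)) = (\<eta> - v) * T 1 \<phi> + T 2 \<phi> - a * (1 + D + \<eta>)"
    using nz by (simp add: divide_eq_eq)
  thus ?thesis using that by (simp add: algebra_simps)
qed

text \<open>\<open>M\<close> is the multiplicity of \<open>v + \<eta>\<close>. Irrational \<eta> is
  allowed, because this equation serves to prove rationality.\<close>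

lemma hexagon_multiplicity:
  assumes k: "k = 6" and \<eta>: "\<eta>\<^sup>2 = D" "\<eta> \<noteq> 0" "v + \<eta> \<noteq> 0"
  obtains M :: nat where "real (2 * M) * (v + \<eta>) = a * D * (1 + D + \<eta>)"
proof -
  interpret H: half_polygon_eigen V W A d k s t "\<lambda>m. (\<eta> - v) * S delta m + S (S delta) m"
    "\<eta> - v" 1 0 "v + \<eta>" by (rule hexagon_eigen[OF k \<eta>(1)])
  note f = hexagon_f_values[OF \<eta>(1)]
  have f\<mu>: "H.f (v + \<eta>) = (v + \<eta>) * (2 * \<eta>)" and fa: "H.f a = a * (1 + D + \<eta>)"
    unfolding H.f_def using f by simp_all
  have nz: "(v + \<eta>) * (2 * \<eta>) \<noteq> 0" using \<eta> by simp
  have "(\<eta> - v) * S delta 0 + S (S delta) 0 = real (t + 1) * (1 + \<eta>)"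
    using k by (simp add: two_step_def delta_def algebra_simps)
  hence "((\<eta> - v) * S delta 0 + S (S delta) 0) * (a - (v + \<eta>)) / real (t + 1) - 1 = \<eta> * D"
    using f(3) by simp
  hence "a * (1 + D + \<eta>) * (\<eta> * D) / ((v + \<eta>) * (2 * \<eta>)) \<in> \<nat>"
    using H.multiplicity_nat nz unfolding f\<mu> fa by (simp only:) simp
  then obtain M :: nat where "a * (1 + D + \<eta>) * (\<eta> * D) / ((v + \<eta>) * (2 * \<eta>)) = real M"
    by (auto elim: Nats_cases)
  hence "real M * ((v + \<eta>) * (2 * \<eta>)) = a * (1 + D + \<eta>) * (\<eta> * D)" using nz by (simp add: divide_eq_eq)
  hence "\<eta> * (real (2 * M) * (v + \<eta>)) = \<eta> * (a * D * (1 + D + \<eta>))" by (simp only: ac_simps of_nat_mult of_nat_numeral)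
  hence "real (2 * M) * (v + \<eta>) = a * D * (1 + D + \<eta>)" by (rule iffD1[OF mult_left_cancel[OF \<eta>(2)]])
  thus ?thesis using that by blast
qed

text \<open>Thickness enters here, to exclude the degenerate case of
  \<open>rational_of_linear_relation\<close>.\<close>

lemma v_neq: "s \<ge> 2 \<Longrightarrow> t \<ge> 2 \<Longrightarrow> v \<noteq> 1 + D"
proof -
  assume st: "s \<ge> 2" "t \<ge> 2"
  have "1 + D - v = (real s - 1) * (real t - 1)" by (simp add: algebra_simps)
  moreover have "(real s - 1) * (real t - 1) > 0" using st by simp
  ultimately show ?thesis by linarith
qed

lemma hexagon_st_square:
  assumes k: "k = 6" and st: "s \<ge> 2" "t \<ge> 2"
  obtains u :: nat where "s * t = u\<^sup>2"
proof -
  define \<eta> where "\<eta> = sqrt D"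
  have \<eta>: "\<eta>\<^sup>2 = D" "\<eta> > 0" using st by (auto simp: \<eta>_def)
  have nz: "\<eta> \<noteq> 0" "v + \<eta> \<noteq> 0" using \<eta> by (auto simp: add_nonneg_eq_0_iff)
  obtain M :: nat where M: "real (2 * M) * (v + \<eta>) = a * D * (1 + D + \<eta>)"
    using hexagon_multiplicity[OF k \<eta>(1) nz] .
  have "\<eta> \<in> \<rat>"
    by (rule rational_of_linear_relation[OF M _ v_neq[OF st]])
      (use st in \<open>auto intro!: Rats_mult Rats_add simp: add_nonneg_eq_0_iff\<close>)
  hence "sqrt (real (s * t)) \<in> \<rat>" by (simp add: \<eta>_def)
  thus ?thesis using sqrt_rational_square that by blast
qed

text \<open>\<open>v\<^sup>2\<close> exceeds \<open>2 * D\<close>, so it cannot equal the square of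
  \<eta>.\<close>

lemma v_bounds:
  assumes st: "s \<ge> 2" "t \<ge> 2" and \<eta>: "\<eta>\<^sup>2 = D \<or> \<eta>\<^sup>2 = 2 * D \<or> \<eta> = 0"
  shows "v + \<eta> \<noteq> 0"
proof
  assume "v + \<eta> = 0"
  hence "\<eta>\<^sup>2 = v\<^sup>2" by (simp add: power2_eq_iff add_eq_0_iff)
  also have "\<dots> = (real s)\<^sup>2 + (real t)\<^sup>2 + 2 * D" by (simp add: power2_eq_square algebra_simps)
  finally have *: "\<eta>\<^sup>2 = (real s)\<^sup>2 + (real t)\<^sup>2 + 2 * D" .
  have "(real s)\<^sup>2 > 0" "(real t)\<^sup>2 > 0" "D > 0" using st by auto
  moreover have "\<eta>\<^sup>2 = D \<or> \<eta>\<^sup>2 = 2 * D \<or> \<eta>\<^sup>2 = 0" using \<eta> by auto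
  ultimately show False using * by linarith
qed

lemma hexagon_coprime:
  assumes k: "k = 6" and st: "s \<ge> 2" "t \<ge> 2" and \<phi>: "isometry \<phi>" and far: "\<And>x. x \<in> V \<Longrightarrow> d x (\<phi> x) \<ge> 4"
  shows "coprime s t"
proof -
  obtain u :: nat where u: "s * t = u\<^sup>2" using hexagon_st_square[OF k st] .
  have u0: "real u \<noteq> 0" using u st by (cases u) auto
  have D: "D = (real u)\<^sup>2" using arg_cong[OF u, of real] by simp
  obtain K1 :: int where K1: "of_int K1 * ((v + u) * (2 * u)) = T 2 \<phi> + (u - v) * T 1 \<phi> - a * (1 + D + u)"
    using hexagon_trace[OF k _ _ _ _ \<phi>, of "real u"] u0 v_bounds[OF st, of u] D by auto
  obtain K2 :: int where K2: "of_int K2 * ((v + - real u) * (2 * - real u)) = T 2 \<phi> + (- real u - v) * T 1 \<phi> - a * (1 + D + - real u)"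
    using hexagon_trace[OF k _ _ _ _ \<phi>, of "- real u"] u0 v_bounds[OF st, of "- real u"] D by auto
  have T1: "T 1 \<phi> = 0" by (rule T1_eq_0) (rule far)
  \<comment> \<open>Subtracting the two trace equations eliminates
    \<open>T 2 \<phi>\<close>.\<close>
  have "2 * real u * (a + of_int K1 * (v + u) + of_int K2 * (v - u)) = 0"
    using K1 K2 unfolding T1 by (simp add: algebra_simps)
  hence "a + of_int K1 * (v + u) + of_int K2 * (v - u) = 0" using u0 by simp
  hence "real_of_int ((1 + int s) * (1 + int t) + 0 * int (s + t) + K1 * (int (s + t) + int u) + K2 * (int (s + t) - int u))
      = real_of_int 0" by (simp add: algebra_simps)
  hence "(1 + int s) * (1 + int t) + 0 * int (s + t) + K1 * (int (s + t) + int u) + K2 * (int (s + t) - int u) = 0"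
    by (simp only: of_int_eq_iff)
  moreover have "int (s * t) dvd (int u)\<^sup>2" using u by simp
  ultimately show ?thesis by (rule coprime_if_combination[rotated])
qed

text \<open>Now \<open>T 2 \<phi>\<close> vanishes as well, and the trace at \<open>v - u\<close>
  alone is an equation in \<open>s\<close> and \<open>t\<close>.\<close>

lemma hexagon_impossible:
  assumes k: "k = 6" and st: "s \<ge> 2" "t \<ge> 2" and \<phi>: "isometry \<phi>" and far: "\<And>x. x \<in> V \<Longrightarrow> d x (\<phi> x) \<ge> 6"
  shows False
proof -
  have far': "d x (\<phi> x) \<ge> 4" if "x \<in> V" for x using far[OF that] by simp
  obtain u :: nat where u: "s * t = u\<^sup>2" using hexagon_st_square[OF k st] .
  have u0: "real u \<noteq> 0" using u st by (cases u) auto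
  have D: "D = (real u)\<^sup>2" using arg_cong[OF u, of real] by simp
  obtain K2 :: int where K2: "of_int K2 * ((v + - real u) * (2 * - real u)) = T 2 \<phi> + (- real u - v) * T 1 \<phi> - a * (1 + D + - real u)"
    using hexagon_trace[OF k _ _ _ _ \<phi>, of "- real u"] u0 v_bounds[OF st, of "- real u"] D by auto
  have T12: "T 1 \<phi> = 0" "T 2 \<phi> = 0" using T1_eq_0[of \<phi>] T2_eq_0[of \<phi>] far far' by blast+
  have "2 * real u * (v - u) * of_int K2 = a * (1 + (real u)\<^sup>2 - u)"
    using K2 unfolding T12 D[symmetric] by (simp add: algebra_simps)
  hence "real_of_int (2 * int u * (int (s + t) - int u) * K2) = real_of_int ((1 + int s) * (1 + int t) * (1 + (int u)\<^sup>2 - int u))"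
    by (simp add: add.commute)
  hence "2 * int u * (int (s + t) - int u) * K2 = (1 + int s) * (1 + int t) * (1 + (int u)\<^sup>2 - int u)"
    by (simp only: of_int_eq_iff)
  thus False
    using hexagon_parameters_impossible[OF st hexagon_coprime[OF k st \<phi> far'], of "int u" K2] u u0 by simp
qed

section \<open>Octagons\<close>

lemma octagon_f_values:
  fixes \<eta> :: real
  assumes "\<eta> * (\<eta>\<^sup>2 - 2 * D) = 0"
  shows "(v\<^sup>2 - \<eta> * v + \<eta>\<^sup>2 - 2 * D) * (v + \<eta>) + (\<eta> - 2 * v) * (v + \<eta>)\<^sup>2 + (v + \<eta>) ^ 3
      = (v + \<eta>) * (3 * \<eta>\<^sup>2 - 2 * D)"
    "(v\<^sup>2 - \<eta> * v + \<eta>\<^sup>2 - 2 * D) * a + (\<eta> - 2 * v) * a\<^sup>2 + a ^ 3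
      = a * ((1 + D)\<^sup>2 + \<eta> * (1 + D) + \<eta>\<^sup>2 - 2 * D)"
  unfolding a_eq by (simp_all add: power2_eq_square power3_eq_cube algebra_simps)

lemma octagon_trace:
  assumes k: "k = 8" and \<eta>: "\<eta> = 0 \<or> \<eta>\<^sup>2 = 2 * D" "\<eta> \<in> \<rat>" "v + \<eta> \<noteq> 0" "D > 0" and \<phi>: "isometry \<phi>"
  obtains K :: int where "of_int K * ((v + \<eta>) * (3 * \<eta>\<^sup>2 - 2 * D))
    = T 3 \<phi> + (\<eta> - 2 * v) * T 2 \<phi> + (v\<^sup>2 - \<eta> * v + \<eta>\<^sup>2 - 2 * D) * T 1 \<phi>
       - a * ((1 + D)\<^sup>2 + \<eta> * (1 + D) + \<eta>\<^sup>2 - 2 * D)"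
proof -
  have \<eta>0: "\<eta> * (\<eta>\<^sup>2 - 2 * D) = 0" using \<eta>(1) by auto
  interpret O: half_polygon_eigen V W A d k s t
    "\<lambda>m. (v\<^sup>2 - \<eta> * v + \<eta>\<^sup>2 - 2 * D) * S delta m + (\<eta> - 2 * v) * S (S delta) m + S (S (S delta)) m"
    "v\<^sup>2 - \<eta> * v + \<eta>\<^sup>2 - 2 * D" "\<eta> - 2 * v" 1 "v + \<eta>" by (rule octagon_eigen[OF k \<eta>0])
  note f = octagon_f_values[OF \<eta>0]
  have f\<mu>: "O.f (v + \<eta>) = (v + \<eta>) * (3 * \<eta>\<^sup>2 - 2 * D)"
    and fa: "O.f a = a * ((1 + D)\<^sup>2 + \<eta> * (1 + D) + \<eta>\<^sup>2 - 2 * D)"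
    unfolding O.f_def using f by simp_all
  let ?n = "(v\<^sup>2 - \<eta> * v + \<eta>\<^sup>2 - 2 * D) * T 1 \<phi> + (\<eta> - 2 * v) * T 2 \<phi> + T 3 \<phi>
     - a * ((1 + D)\<^sup>2 + \<eta> * (1 + D) + \<eta>\<^sup>2 - 2 * D)"
  let ?m = "(v + \<eta>) * (3 * \<eta>\<^sup>2 - 2 * D)"
  \<comment> \<open>The second factor is the derivative of \<open>y (y\<^sup>2 - 2 D)\<close> at
    \<eta>; its value is \<open>- 2 * D\<close> or \<open>4 * D\<close>.\<close>
  have nz: "?m \<noteq> 0" using \<eta> by auto
  have "algebraic_int (?n / ?m)"
    using O.algebraic_int_T[of \<phi>] \<phi> nz unfolding isometry_def f\<mu> fa by simp
  moreover have "?n / ?m \<in> \<rat>"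
    using \<eta>(2) T_Ints[of 1 \<phi>] T_Ints[of 2 \<phi>] T_Ints[of 3 \<phi>] Ints_subset_Rats
    by (intro Rats_divide Rats_diff Rats_mult Rats_add Rats_power) auto
  ultimately obtain K :: int where "?n / ?m = of_int K" using algebraic_int_rat_eq by blast
  hence "of_int K * ?m = ?n" using nz by (simp add: divide_eq_eq)
  thus ?thesis using that by (simp add: ac_simps)
qed

text \<open>Applied with \<open>\<eta> = sqrt (2 * D)\<close> to prove this root rational, and with
  \<open>\<eta> = 0\<close> for a divisibility by \<open>v\<close>.\<close>

lemma octagon_multiplicity:
  assumes k: "k = 8" and \<eta>: "\<eta> = 0 \<or> \<eta>\<^sup>2 = 2 * D" "v + \<eta> \<noteq> 0" "D > 0"
  obtains M :: nat where "real M * ((v + \<eta>) * (3 * \<eta>\<^sup>2 - 2 * D))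
    = a * ((1 + D)\<^sup>2 + \<eta> * (1 + D) + \<eta>\<^sup>2 - 2 * D) * ((1 + \<eta> + \<eta>\<^sup>2 - D) * (1 + D - \<eta>) - 1)"
proof -
  have \<eta>0: "\<eta> * (\<eta>\<^sup>2 - 2 * D) = 0" using \<eta>(1) by auto
  let ?g = "\<lambda>m. (v\<^sup>2 - \<eta> * v + \<eta>\<^sup>2 - 2 * D) * S delta m + (\<eta> - 2 * v) * S (S delta) m + S (S (S delta)) m"
  interpret O: half_polygon_eigen V W A d k s t ?g
    "v\<^sup>2 - \<eta> * v + \<eta>\<^sup>2 - 2 * D" "\<eta> - 2 * v" 1 "v + \<eta>" by (rule octagon_eigen[OF k \<eta>0])
  note f = octagon_f_values[OF \<eta>0]
  have f\<mu>: "O.f (v + \<eta>) = (v + \<eta>) * (3 * \<eta>\<^sup>2 - 2 * D)"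
    and fa: "O.f a = a * ((1 + D)\<^sup>2 + \<eta> * (1 + D) + \<eta>\<^sup>2 - 2 * D)"
    unfolding O.f_def using f by simp_all
  have nz: "(v + \<eta>) * (3 * \<eta>\<^sup>2 - 2 * D) \<noteq> 0" using \<eta> by auto
  have "?g 0 = real (t + 1) * (1 + \<eta> + \<eta>\<^sup>2 - D)"
    using k by (simp add: two_step_def delta_def power2_eq_square algebra_simps)
  hence "?g 0 * (a - (v + \<eta>)) / real (t + 1) - 1 = (1 + \<eta> + \<eta>\<^sup>2 - D) * (1 + D - \<eta>) - 1"
    unfolding a_eq by simp
  hence "a * ((1 + D)\<^sup>2 + \<eta> * (1 + D) + \<eta>\<^sup>2 - 2 * D) * ((1 + \<eta> + \<eta>\<^sup>2 - D) * (1 + D - \<eta>) - 1)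
      / ((v + \<eta>) * (3 * \<eta>\<^sup>2 - 2 * D)) \<in> \<nat>"
    using O.multiplicity_nat nz unfolding f\<mu> fa by (simp only:) simp
  then obtain M :: nat where "a * ((1 + D)\<^sup>2 + \<eta> * (1 + D) + \<eta>\<^sup>2 - 2 * D)
      * ((1 + \<eta> + \<eta>\<^sup>2 - D) * (1 + D - \<eta>) - 1) / ((v + \<eta>) * (3 * \<eta>\<^sup>2 - 2 * D)) = real M"
    by (auto elim: Nats_cases)
  hence "real M * ((v + \<eta>) * (3 * \<eta>\<^sup>2 - 2 * D)) = a * ((1 + D)\<^sup>2 + \<eta> * (1 + D) + \<eta>\<^sup>2 - 2 * D)
      * ((1 + \<eta> + \<eta>\<^sup>2 - D) * (1 + D - \<eta>) - 1)" by (simp only: nonzero_divide_eq_eq[OF nz])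
  thus ?thesis using that by blast
qed

lemma octagon_2st_square:
  assumes k: "k = 8" and st: "s \<ge> 2" "t \<ge> 2"
  obtains w :: nat where "2 * (s * t) = w\<^sup>2"
proof -
  define \<eta> where "\<eta> = sqrt (2 * D)"
  have D0: "D > 0" using st by simp
  have \<eta>: "\<eta>\<^sup>2 = 2 * D" "\<eta> > 0" using D0 by (auto simp: \<eta>_def)
  obtain M :: nat where M: "real M * ((v + \<eta>) * (3 * \<eta>\<^sup>2 - 2 * D))
    = a * ((1 + D)\<^sup>2 + \<eta> * (1 + D) + \<eta>\<^sup>2 - 2 * D) * ((1 + \<eta> + \<eta>\<^sup>2 - D) * (1 + D - \<eta>) - 1)"
    using octagon_multiplicity[OF k _ v_bounds[OF st] D0] \<eta> by blast
  have "(1 + \<eta> + \<eta>\<^sup>2 - D) * (1 + D - \<eta>) - 1 = D\<^sup>2 + 2 * D - \<eta>\<^sup>2"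
    unfolding \<eta>(1) by (simp add: power2_eq_square[of \<eta>, symmetric] \<eta>(1) algebra_simps) (simp add: power2_eq_square)
  hence f: "(1 + \<eta> + \<eta>\<^sup>2 - D) * (1 + D - \<eta>) - 1 = D * D"
    "(1 + D)\<^sup>2 + \<eta> * (1 + D) + \<eta>\<^sup>2 - 2 * D = (1 + D) * (1 + D + \<eta>)" "3 * \<eta>\<^sup>2 - 2 * D = 4 * D"
    unfolding \<eta>(1) by (simp_all add: power2_eq_square algebra_simps)
  hence "D * (real (4 * M) * (v + \<eta>)) = D * (a * (1 + D) * D * (1 + D + \<eta>))"
    using M unfolding f by (simp only: of_nat_mult of_nat_numeral ac_simps)
  hence M': "real (4 * M) * (v + \<eta>) = a * (1 + D) * D * (1 + D + \<eta>)" 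
    by (rule iffD1[OF mult_left_cancel[OF less_imp_neq[OF D0, symmetric]]])
  have "\<eta> \<in> \<rat>"
    by (rule rational_of_linear_relation[OF M' _ v_neq[OF st]])
      (use st D0 in \<open>auto intro!: Rats_mult Rats_add simp: add_nonneg_eq_0_iff\<close>)
  hence "sqrt (real (2 * (s * t))) \<in> \<rat>" by (simp add: \<eta>_def)
  thus ?thesis using sqrt_rational_square that by blast
qed

lemma octagon_trace_pm:
  assumes k: "k = 8" and st: "s \<ge> 2" "t \<ge> 2" and w: "2 * (s * t) = w\<^sup>2" and \<eta>: "\<eta> = real w \<or> \<eta> = - real w"
    and \<phi>: "isometry \<phi>" and far: "\<And>x. x \<in> V \<Longrightarrow> d x (\<phi> x) \<ge> 4"
  obtains K :: int where "of_int K * (v + \<eta>) * (4 * D) = T 3 \<phi> + (\<eta> - 2 * v) * T 2 \<phi> - a * ((1 + D) * (1 + D + \<eta>))"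
proof -
  have D0: "D > 0" using st by simp
  have "2 * D = (real w)\<^sup>2" using arg_cong[OF w, of real] by simp
  hence \<eta>2: "\<eta>\<^sup>2 = 2 * D" using \<eta> by auto
  have \<eta>r: "\<eta> \<in> \<rat>" using \<eta> by auto
  obtain K :: int where K: "of_int K * ((v + \<eta>) * (3 * \<eta>\<^sup>2 - 2 * D))
    = T 3 \<phi> + (\<eta> - 2 * v) * T 2 \<phi> + (v\<^sup>2 - \<eta> * v + \<eta>\<^sup>2 - 2 * D) * T 1 \<phi>
       - a * ((1 + D)\<^sup>2 + \<eta> * (1 + D) + \<eta>\<^sup>2 - 2 * D)"
    using octagon_trace[OF k _ \<eta>r v_bounds[OF st] D0 \<phi>] \<eta>2 by blast
  have "(1 + D)\<^sup>2 + \<eta> * (1 + D) + \<eta>\<^sup>2 - 2 * D = (1 + D) * (1 + D + \<eta>)" "3 * \<eta>\<^sup>2 - 2 * D = 4 * D"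
    unfolding \<eta>2 by (simp_all add: power2_eq_square algebra_simps)
  moreover have T1: "T 1 \<phi> = 0" by (rule T1_eq_0) (rule far)
  ultimately show ?thesis using that[of K] K unfolding T1 by (simp add: mult.assoc)
qed

lemma octagon_coprime:
  assumes k: "k = 8" and st: "s \<ge> 2" "t \<ge> 2" and \<phi>: "isometry \<phi>" and far: "\<And>x. x \<in> V \<Longrightarrow> d x (\<phi> x) \<ge> 4"
  shows "coprime s t"
proof -
  obtain w :: nat where w: "2 * (s * t) = w\<^sup>2" using octagon_2st_square[OF k st] .
  have D0: "D > 0" using st by simp
  obtain K1 :: int where K1: "of_int K1 * (v + w) * (4 * D) = T 3 \<phi> + (w - 2 * v) * T 2 \<phi> - a * ((1 + D) * (1 + D + w))"
    using octagon_trace_pm[OF k st w _ \<phi> far, of "real w"] by blast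
  obtain K2 :: int where K2: "of_int K2 * (v + - real w) * (4 * D) = T 3 \<phi> + (- real w - 2 * v) * T 2 \<phi> - a * ((1 + D) * (1 + D + - real w))"
    using octagon_trace_pm[OF k st w _ \<phi> far, of "- real w"] by blast
  obtain K0 :: int where K0: "of_int K0 * ((v + 0) * (3 * 0\<^sup>2 - 2 * D))
    = T 3 \<phi> + (0 - 2 * v) * T 2 \<phi> + (v\<^sup>2 - 0 * v + 0\<^sup>2 - 2 * D) * T 1 \<phi>
       - a * ((1 + D)\<^sup>2 + 0 * (1 + D) + 0\<^sup>2 - 2 * D)"
    using octagon_trace[OF k _ _ v_bounds[OF st] D0 \<phi>, of 0] Rats_0 by blast
  have T1: "T 1 \<phi> = 0" by (rule T1_eq_0) (rule far)
  have K0': "of_int K0 * v * (2 * D) = - T 3 \<phi> + 2 * v * T 2 \<phi> + a * ((1 + D) * (1 + D)) - 2 * D * a"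
    using K0 unfolding T1 by (simp add: power2_eq_square[of "1 + D"] algebra_simps)
  \<comment> \<open>Weights 2, 1, 1 on the equations for \<open>K0\<close>, \<open>K1\<close>,
    \<open>K2\<close> cancel both \<open>T 2 \<phi>\<close> and \<open>T 3 \<phi>\<close>.\<close>
  have "(4 * D) * (a + of_int K0 * v + of_int K1 * (v + w) + of_int K2 * (v - w))
    = 4 * D * a + 2 * (of_int K0 * v * (2 * D)) + of_int K1 * (v + w) * (4 * D) + of_int K2 * (v + - real w) * (4 * D)"
    by (simp add: algebra_simps)
  also have "\<dots> = 0" unfolding K0' K1 K2 by (simp add: algebra_simps)
  finally have "a + of_int K0 * v + of_int K1 * (v + w) + of_int K2 * (v - w) = 0" using st by simp
  hence "real_of_int ((1 + int s) * (1 + int t) + K0 * int (s + t) + K1 * (int (s + t) + int w) + K2 * (int (s + t) - int w))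
      = real_of_int 0" by (simp add: algebra_simps)
  hence "(1 + int s) * (1 + int t) + K0 * int (s + t) + K1 * (int (s + t) + int w) + K2 * (int (s + t) - int w) = 0"
    by (simp only: of_int_eq_iff)
  moreover have "int (s * t) dvd (int w)\<^sup>2" using arg_cong[OF w, of int] by (metis dvd_triv_right of_nat_mult of_nat_power)
  ultimately show ?thesis by (rule coprime_if_combination[rotated])
qed

lemma octagon_impossible:
  assumes k: "k = 8" and st: "s \<ge> 2" "t \<ge> 2" and \<phi>: "isometry \<phi>" and far: "\<And>x. x \<in> V \<Longrightarrow> d x (\<phi> x) \<ge> 6"
  shows False
proof -
  have far': "d x (\<phi> x) \<ge> 4" if "x \<in> V" for x using far[OF that] by simp
  obtain w :: nat where w: "2 * (s * t) = w\<^sup>2" using octagon_2st_square[OF k st] .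
  have w0: "w > 0" using w st by (auto intro!: Nat.gr0I)
  have D0: "D > 0" using st by simp
  have D2: "2 * D = (real w)\<^sup>2" using arg_cong[OF w, of real] by simp
  obtain K1 :: int where K1: "of_int K1 * (v + w) * (4 * D) = T 3 \<phi> + (w - 2 * v) * T 2 \<phi> - a * ((1 + D) * (1 + D + w))"
    using octagon_trace_pm[OF k st w _ \<phi> far', of "real w"] by blast
  obtain K2 :: int where K2: "of_int K2 * (v + - real w) * (4 * D) = T 3 \<phi> + (- real w - 2 * v) * T 2 \<phi> - a * ((1 + D) * (1 + D + - real w))"
    using octagon_trace_pm[OF k st w _ \<phi> far', of "- real w"] by blast
  have T2: "T 2 \<phi> = 0" by (rule T2_eq_0) (rule far)
  \<comment> \<open>With \<open>T 2 \<phi> = 0\<close> the difference of the two traces also loses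
    \<open>T 3 \<phi>\<close>.\<close>
  have "(of_int K2 * (v - w) - of_int K1 * (v + w)) * (2 * (2 * D)) = 2 * (w * (a * (1 + D)))"
    using K1 K2 unfolding T2 by (simp add: algebra_simps)
  moreover have "w * X = Y" if "X * (2 * (2 * D)) = 2 * (w * Y)" for X Y :: real
  proof -
    have "(2 * real w) * (w * X - Y) = X * (2 * (2 * D)) - 2 * (w * Y)"
      unfolding D2 by (simp add: power2_eq_square right_diff_distrib)
    also have "\<dots> = 0" using that by (simp only: right_minus_eq)
    finally show ?thesis using w0 by simp
  qed
  ultimately have "w * (of_int K2 * (v - w) - of_int K1 * (v + w)) = a * (1 + D)" by blast
  hence "real_of_int (int w * (K2 * (int (s + t) - int w) - K1 * (int (s + t) + int w)))
      = real_of_int ((1 + int s) * (1 + int t) * (1 + int (s * t)))" by (simp add: add.commute)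
  hence eq: "int w * (K2 * (int (s + t) - int w) - K1 * (int (s + t) + int w)) = (1 + int s) * (1 + int t) * (1 + int (s * t))"
    by (simp only: of_int_eq_iff)
  obtain M :: nat where M: "real M * ((v + 0) * (3 * 0\<^sup>2 - 2 * D))
    = a * ((1 + D)\<^sup>2 + 0 * (1 + D) + 0\<^sup>2 - 2 * D) * ((1 + 0 + 0\<^sup>2 - D) * (1 + D - 0) - 1)"
    using octagon_multiplicity[OF k _ v_bounds[OF st] D0, of 0] by blast
  have "(1 + D)\<^sup>2 - 2 * D = 1 + D\<^sup>2" "(1 - D) * (1 + D) - 1 = - D * D" by (simp_all add: power2_eq_square algebra_simps)
  hence "real M * (v * (- 2 * D)) = a * (1 + D\<^sup>2) * (- D * D)" using M by simp
  hence "- D * (2 * v * real M) = - D * (a * D * (1 + D\<^sup>2))" by (simp only: ac_simps mult_minus_left mult_minus_right)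
  hence "2 * v * real M = a * D * (1 + D\<^sup>2)" using st by simp
  hence "real_of_int (2 * int (s + t) * int M) = real_of_int ((1 + int s) * (1 + int t) * int (s * t) * (1 + (int (s * t))\<^sup>2))"
    by (simp add: add.commute)
  hence mult: "2 * int (s + t) * int M = (1 + int s) * (1 + int t) * int (s * t) * (1 + (int (s * t))\<^sup>2)"
    by (simp only: of_int_eq_iff)
  have "(int w)\<^sup>2 = 2 * int (s * t)" using arg_cong[OF w, of int] by simp
  thus False
    using octagon_parameters_impossible[OF st octagon_coprime[OF k st \<phi> far'] _ _ eq mult] w0 by simp
qed

end

section \<open>Collineations and dualities\<close>

context polygon begin

lemma nbr_P: "p \<in> P \<Longrightarrow> {z. (p, z) \<in> A} = lines_on \<Gamma> p"
  and nbr_L: "l \<in> L \<Longrightarrow> {z. (l, z) \<in> A} = points_on \<Gamma> l"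
  using plg unfolding point_line_geometry_def lines_on_def points_on_def adjacency_def by auto

lemma P_L_nonempty: "P \<noteq> {}" "L \<noteq> {}"
proof -
  obtain x where x: "x \<in> E" using nonempty by auto
  obtain \<Delta> where op: "ordinary_polygon k \<Delta>" and sub: "subgeometry \<Delta> \<Gamma>"
    using gp x unfolding generalised_polygon_def by blast
  obtain p l where pl: "bij_betw p {..<k} (Points \<Delta>)" "bij_betw l {..<k} (Lines \<Delta>)"
    using op unfolding ordinary_polygon_def by blast
  have "(0::nat) \<in> {..<k}" using k2 by auto
  hence "p 0 \<in> Points \<Delta>" "l 0 \<in> Lines \<Delta>" using pl unfolding bij_betw_def by blast+
  thus "P \<noteq> {}" "L \<noteq> {}" using sub unfolding subgeometry_def by auto
qed

lemma half_polygon: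
  assumes fin: "finite E" and par: "has_parameters \<Gamma> s t" and k: "even k" "k \<ge> 4"
  shows "half_polygon P L A d k s t" "half_polygon L P A d k t s"
proof -
  have fin': "finite P" "finite L" using fin PL by auto
  have c: "card {z. (p, z) \<in> A} = t + 1" if "p \<in> P" for p
    using par that unfolding has_parameters_def nbr_P[OF that] by auto
  have c': "card {z. (l, z) \<in> A} = s + 1" if "l \<in> L" for l
    using par that unfolding has_parameters_def nbr_L[OF that] by auto
  \<comment> \<open>Points and lines play symmetric roles; passing to the dual exchanges
    \<open>s\<close> and \<open>t\<close>.\<close>
  have gen: "half_polygon V W A d k s' t'"
    if VW: "finite V" "finite W" "V \<inter> W = {}" "V \<noteq> {}" "V \<union> W = E"
      and nbr: "\<And>y z. y \<in> V \<Longrightarrow> (y, z) \<in> A \<Longrightarrow> z \<in> W" "\<And>y z. y \<in> W \<Longrightarrow> (y, z) \<in> A \<Longrightarrow> z \<in> V"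
      and crd: "\<And>y. y \<in> V \<Longrightarrow> card {z. (y, z) \<in> A} = t' + 1" "\<And>y. y \<in> W \<Longrightarrow> card {z. (y, z) \<in> A} = s' + 1"
      and parity: "\<And>x y. x \<in> V \<Longrightarrow> y \<in> E \<Longrightarrow> even (d x y) \<longleftrightarrow> y \<in> V" for V W s' t'
  proof (unfold_locales, unfold VW(5))
    show "finite V" "finite W" "V \<inter> W = {}" "V \<noteq> {}" "even k" "k \<ge> 4" by fact+
    fix x y z
    show "y \<in> V \<Longrightarrow> (y, z) \<in> A \<Longrightarrow> z \<in> W" "y \<in> W \<Longrightarrow> (y, z) \<in> A \<Longrightarrow> z \<in> V"
      by (fact nbr)+
    show "y \<in> V \<Longrightarrow> card {z. (y, z) \<in> A} = t' + 1" "y \<in> W \<Longrightarrow> card {z. (y, z) \<in> A} = s' + 1"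
      by (fact crd)+
    show "x \<in> V \<Longrightarrow> y \<in> E \<Longrightarrow> even (d x y) \<longleftrightarrow> y \<in> V" by (fact parity)
    show "d x y = d y x" by (fact d_sym)
    show "x \<in> E \<Longrightarrow> y \<in> E \<Longrightarrow> d x y \<le> k" by (fact d_le)
    show "x \<in> E \<Longrightarrow> y \<in> E \<Longrightarrow> d x y = 0 \<longleftrightarrow> x = y" by (fact d_eq_0)
    show "(y, z) \<in> A \<Longrightarrow> x \<in> E \<Longrightarrow> d x z = Suc (d x y) \<or> d x y = Suc (d x z)" by (fact d_step)
    show "x \<in> E \<Longrightarrow> y \<in> E \<Longrightarrow> 0 < d x y \<Longrightarrow> d x y < k \<Longrightarrow>
        card {z. (y, z) \<in> A \<and> d x y = Suc (d x z)} = 1" by (fact card_pred)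
  qed
  show "half_polygon P L A d k s t"
    by (rule gen) (use fin' PL P_L_nonempty A_P c c' d_parity in auto)
  show "half_polygon L P A d k t s"
    by (rule gen) (use fin' PL P_L_nonempty A_P c c' d_parity in auto)
qed

lemma collineation_relpow:
  assumes \<theta>: "preserves_incidence \<Gamma> \<theta>" and x: "x \<in> E" and m: "(x, y) \<in> A ^^ m"
  shows "(\<theta> x, \<theta> y) \<in> A ^^ m"
  using m
proof (induction m arbitrary: y)
  case (Suc m)
  then obtain z where z: "(x, z) \<in> A ^^ m" "(z, y) \<in> A" by auto
  have "(\<theta> z, \<theta> y) \<in> A"
    using \<theta> z(2) A_E[OF z(2)] unfolding preserves_incidence_def by blast
  thus ?case using Suc.IH[OF z(1)] by auto
qed auto

text \<open>Surjectivity is used to pull the intermediate elements of the walk back.\<close>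

lemma relpow_collineation:
  assumes \<theta>: "preserves_incidence \<Gamma> \<theta>" and x: "x \<in> E" and y: "y \<in> E" and m: "(\<theta> x, \<theta> y) \<in> A ^^ m"
  shows "(x, y) \<in> A ^^ m"
  using y m
proof (induction m arbitrary: y)
  case 0
  thus ?case using \<theta> x unfolding preserves_incidence_def bij_betw_def by (auto dest: inj_onD)
next
  case (Suc m)
  then obtain z where z: "(\<theta> x, z) \<in> A ^^ m" "(z, \<theta> y) \<in> A" by auto
  have "z \<in> \<theta> ` E" using \<theta> A_E(1)[OF z(2)] unfolding preserves_incidence_def bij_betw_def by simp
  then obtain z' where z': "z' \<in> E" "z = \<theta> z'" by blast
  have "(z', y) \<in> A" using \<theta> z(2) z' Suc.prems unfolding preserves_incidence_def by blast
  thus ?case using Suc.IH[OF z'(1)] z(1) z'(2) by auto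
qed

lemma d_image:
  assumes "preserves_incidence \<Gamma> \<theta>" "x \<in> E" "y \<in> E"
  shows "d (\<theta> x) (\<theta> y) = d x y"
proof -
  have "(\<theta> x, \<theta> y) \<in> A ^^ m \<longleftrightarrow> (x, y) \<in> A ^^ m" for m
    using collineation_relpow relpow_collineation assms by metis
  thus ?thesis unfolding inc_dist_def by simp
qed

text \<open>The values of \<theta> outside the geometry are arbitrary, so it is replaced by the
  identity off \<open>V\<close> to obtain a permutation.\<close>

lemma isometry_restrict:
  assumes hp: "half_polygon V W A d k s' t'" and V: "V \<subseteq> E"
    and \<theta>: "preserves_incidence \<Gamma> \<theta>" "\<theta> ` V = V"
  shows "half_polygon.isometry V d (\<lambda>x. if x \<in> V then \<theta> x else x)"
proof -
  have "inj_on \<theta> V" using \<theta>(1) V unfolding preserves_incidence_def bij_betw_def by (auto intro: inj_on_subset)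
  hence "bij_betw (\<lambda>x. if x \<in> V then \<theta> x else x) V V"
    using \<theta>(2) by (auto simp: bij_betw_def inj_on_def)
  hence "(\<lambda>x. if x \<in> V then \<theta> x else x) permutes V" by (rule bij_imp_permutes) simp
  thus ?thesis using d_image[OF \<theta>(1)] V unfolding half_polygon.isometry_def[OF hp] by (auto simp: subset_iff)
qed

text \<open>Chambers are unordered pairs, so the types decide which image is the point. In the last
  claim, the case of a duality, the line of the image chamber is \<open>\<theta> p\<close>.\<close>

lemma opposite_chambers_opposite:
  assumes "(p, l) \<in> Inc \<Gamma>" and opp: "opposite_chambers n \<Gamma> {p, l} {\<theta> p, \<theta> l}"
  shows "\<theta> p \<in> P \<Longrightarrow> d p (\<theta> p) = 2 * n" "\<theta> p \<in> P \<Longrightarrow> d l (\<theta> l) = 2 * n"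
    "\<theta> p \<in> L \<Longrightarrow> d l (\<theta> p) = 2 * n"
proof -
  obtain p1 l1 p2 l2 where *: "(p1, l1) \<in> Inc \<Gamma>" "(p2, l2) \<in> Inc \<Gamma>" "{p, l} = {p1, l1}"
    "{\<theta> p, \<theta> l} = {p2, l2}" "opposite n \<Gamma> p1 p2" "opposite n \<Gamma> l1 l2"
    using opp unfolding opposite_chambers_def by blast
  have in_PL: "p \<in> P" "l \<in> L" "p1 \<in> P" "l1 \<in> L" "p2 \<in> P" "l2 \<in> L"
    using plg assms(1) *(1,2) unfolding point_line_geometry_def by auto
  hence 1: "p1 = p" "l1 = l" using *(3) PL(1) by (auto simp: doubleton_eq_iff)
  have d: "d p p2 = 2 * n" "d l l2 = 2 * n" using *(5,6) 1 unfolding opposite_def by auto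
  show "d p (\<theta> p) = 2 * n" "d l (\<theta> l) = 2 * n" if "\<theta> p \<in> P"
    using that *(4) d in_PL PL(1) by (auto simp: doubleton_eq_iff)
  show "d l (\<theta> p) = 2 * n" if "\<theta> p \<in> L"
    using that *(4) d in_PL PL(1) by (auto simp: doubleton_eq_iff)
qed

lemma anisotropic_flag:
  assumes "anisotropic n \<Gamma> \<theta>" "(p, l) \<in> Inc \<Gamma>"
  shows "opposite_chambers n \<Gamma> {p, l} {\<theta> p, \<theta> l}"
proof -
  have "{p, l} \<in> chambers \<Gamma>" using assms(2) unfolding chambers_def by blast
  hence "opposite_chambers n \<Gamma> {p, l} (\<theta> ` {p, l})" using assms(1) unfolding anisotropic_def by blast
  thus ?thesis by simp
qed

lemma no_anisotropic_duality:
  assumes k: "k = 2 * n" and \<theta>: "duality \<Gamma> \<theta>" "anisotropic n \<Gamma> \<theta>"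
  shows False
proof -
  obtain p where p: "p \<in> P" using P_L_nonempty by auto
  have \<theta>p: "\<theta> p \<in> L" using \<theta>(1) p unfolding duality_def by auto
  have E: "p \<in> E" "\<theta> p \<in> E" using p \<theta>p PL by auto
  have "odd (d (\<theta> p) p)" using d_parity[OF E(2,1)] p \<theta>p PL by auto
  then obtain m where m: "d (\<theta> p) p = Suc m" by (metis even_zero not0_implies_Suc)
  obtain l where l: "(l, p) \<in> A" "d (\<theta> p) l = m" using d_pred[OF E(2,1) m] .
  have "(p, l) \<in> Inc \<Gamma>" using l(1) p plg unfolding adjacency_def point_line_geometry_def by auto
  \<comment> \<open>Now \<open>p\<close>, one step farther from \<open>\<theta> p\<close> than
    \<open>l\<close>, would be at distance \<open>2 * n + 1\<close>, beyond the diameter.\<close>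
  hence "d l (\<theta> p) = 2 * n" using opposite_chambers_opposite(3) anisotropic_flag[OF \<theta>(2)] \<theta>p by blast
  hence "m = 2 * n" using l(2) d_sym by metis
  thus False using m d_le[OF E(2,1)] k by simp
qed

lemma anisotropic_collineation_points:
  assumes \<theta>: "collineation \<Gamma> \<theta>" "anisotropic n \<Gamma> \<theta>" and p: "p \<in> P"
  shows "d p (\<theta> p) = 2 * n"
proof -
  have \<theta>p: "\<theta> p \<in> P" using \<theta>(1) p unfolding collineation_def by auto
  \<comment> \<open>Any line serves: the last step of a geodesic from it to \<open>p\<close> gives a
    line through \<open>p\<close>.\<close>
  obtain l where l: "l \<in> L" using P_L_nonempty by auto
  have E: "p \<in> E" "l \<in> E" using p l PL by auto
  have "d l p \<noteq> 0" using d_eq_0[of l p] E p l PL by auto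
  then obtain m where m: "d l p = Suc m" by (metis not0_implies_Suc)
  obtain l' where l': "(l', p) \<in> A" using d_pred[OF E(2,1) m] by blast
  have "(p, l') \<in> Inc \<Gamma>" using l' p plg unfolding adjacency_def point_line_geometry_def by auto
  thus ?thesis using opposite_chambers_opposite(1) anisotropic_flag[OF \<theta>(2)] \<theta>p by blast
qed

lemma thick_parameters:
  assumes "thick \<Gamma>" "finite E" "has_parameters \<Gamma> s t"
  shows "s \<ge> 2" "t \<ge> 2"
proof -
  obtain p l where pl: "p \<in> P" "l \<in> L" using P_L_nonempty by auto
  have "lines_on \<Gamma> p \<subseteq> E" "points_on \<Gamma> l \<subseteq> E"
    using plg PL unfolding lines_on_def points_on_def point_line_geometry_def by auto
  hence "finite (lines_on \<Gamma> p)" "finite (points_on \<Gamma> l)" using assms(2) finite_subset by blast+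
  moreover have "card (lines_on \<Gamma> p) = t + 1" "card (points_on \<Gamma> l) = s + 1"
    using assms(3) pl unfolding has_parameters_def by auto
  ultimately have "t + 1 \<ge> 3" "s + 1 \<ge> 3" using assms(1) pl unfolding thick_def by metis+
  thus "s \<ge> 2" "t \<ge> 2" by auto
qed

text \<open>Displacement at least 4 kills \<open>T 1\<close>, and at least 6 also
  \<open>T 2\<close>. The condition on lines is the one on points of the dual polygon.\<close>

lemma collineation_displacement:
  assumes th: "thick \<Gamma>" and fin: "finite E" and par: "has_parameters \<Gamma> s t"
    and \<theta>: "collineation \<Gamma> \<theta>"
    and far: "(\<forall>l\<in>L. d l (\<theta> l) \<ge> m) \<or> (\<forall>p\<in>P. d p (\<theta> p) \<ge> m)"
  shows "k = 4 \<Longrightarrow> m = 4 \<Longrightarrow> coprime s t" "k = 6 \<Longrightarrow> m = 4 \<Longrightarrow> coprime s t" "k = 8 \<Longrightarrow> m = 4 \<Longrightarrow> coprime s t"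
    "k = 6 \<Longrightarrow> m = 6 \<Longrightarrow> False" "k = 8 \<Longrightarrow> m = 6 \<Longrightarrow> False"
proof -
  note st = thick_parameters[OF th fin par]
  have pres: "preserves_incidence \<Gamma> \<theta>" and im: "\<theta> ` P = P" "\<theta> ` L = L"
    using \<theta> unfolding collineation_def by auto
  have main: "(k = 4 \<longrightarrow> m = 4 \<longrightarrow> coprime s' t') \<and> (k = 6 \<longrightarrow> m = 4 \<longrightarrow> coprime s' t') \<and> (k = 8 \<longrightarrow> m = 4 \<longrightarrow> coprime s' t')
      \<and> \<not> (k = 6 \<and> m = 6) \<and> \<not> (k = 8 \<and> m = 6)"
    if hp: "half_polygon V W A d k s' t'" and V: "V \<subseteq> E" "\<theta> ` V = V" and st': "s' \<ge> 2" "t' \<ge> 2"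
      and far': "\<And>x. x \<in> V \<Longrightarrow> d x (\<theta> x) \<ge> m" for V W s' t'
  proof -
    interpret half_polygon V W A d k s' t' by (rule hp)
    let ?\<phi> = "\<lambda>x. if x \<in> V then \<theta> x else x"
    have iso: "isometry ?\<phi>" by (rule isometry_restrict[OF hp V(1) pres V(2)])
    have far: "\<And>x. x \<in> V \<Longrightarrow> d x (?\<phi> x) \<ge> m" using far' by simp
    have s0: "s' > 0" using st' by simp
    show ?thesis
      using quadrangle_coprime[OF _ s0 iso] hexagon_coprime[OF _ st' iso] octagon_coprime[OF _ st' iso]
        hexagon_impossible[OF _ st' iso] octagon_impossible[OF _ st' iso] far by blast
  qed
  have res: "(k = 4 \<longrightarrow> m = 4 \<longrightarrow> coprime s t) \<and> (k = 6 \<longrightarrow> m = 4 \<longrightarrow> coprime s t) \<and> (k = 8 \<longrightarrow> m = 4 \<longrightarrow> coprime s t)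
      \<and> \<not> (k = 6 \<and> m = 6) \<and> \<not> (k = 8 \<and> m = 6)"
  proof (cases "even k \<and> k \<ge> 4")
    case True
    note hp = half_polygon[OF fin par] True
    from far show ?thesis
    proof
      assume "\<forall>l\<in>L. d l (\<theta> l) \<ge> m"
      thus ?thesis
        \<comment> \<open>The parameters are interchanged here, and coprimality is
          symmetric.\<close>
        using main[OF hp(2) _ im(2) st(2,1)] True PL by (auto simp: coprime_commute)
    next
      assume "\<forall>p\<in>P. d p (\<theta> p) \<ge> m"
      thus ?thesis
        using main[OF hp(1) _ im(1) st] True PL by auto
    qed
  qed auto
  thus "k = 4 \<Longrightarrow> m = 4 \<Longrightarrow> coprime s t" "k = 6 \<Longrightarrow> m = 4 \<Longrightarrow> coprime s t" "k = 8 \<Longrightarrow> m = 4 \<Longrightarrow> coprime s t"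
    "k = 6 \<Longrightarrow> m = 6 \<Longrightarrow> False" "k = 8 \<Longrightarrow> m = 6 \<Longrightarrow> False" by blast+
qed

end

theorem theorem10p2:
  fixes \<Gamma> :: "'a geometry" and n :: nat
  assumes "n \<ge> 1" and "generalised_polygon (2 * n) \<Gamma>" and "thick \<Gamma>"
  shows "(\<nexists>\<theta>. duality \<Gamma> \<theta> \<and> anisotropic n \<Gamma> \<theta>) \<and>
    (\<forall>s t. finite (Elements \<Gamma>) \<and> has_parameters \<Gamma> s t \<longrightarrow>
      (n = 2 \<longrightarrow>
        (\<exists>\<theta>. collineation \<Gamma> \<theta> \<and> anisotropic n \<Gamma> \<theta>) \<longrightarrow> coprime s t) \<and>
      (n = 3 \<longrightarrow>
        (\<nexists>\<theta>. collineation \<Gamma> \<theta> \<and> anisotropic n \<Gamma> \<theta>) \<and>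
        (\<forall>\<theta>. collineation \<Gamma> \<theta> \<and>
             ((\<forall>L\<in>Lines \<Gamma>. inc_dist \<Gamma> L (\<theta> L) \<in> {4, 6}) \<or>
              (\<forall>p\<in>Points \<Gamma>. inc_dist \<Gamma> p (\<theta> p) \<in> {4, 6})) \<longrightarrow> coprime s t)) \<and>
      (n = 4 \<longrightarrow>
        (\<nexists>\<theta>. collineation \<Gamma> \<theta> \<and> anisotropic n \<Gamma> \<theta>) \<and>
        (\<nexists>\<theta>. collineation \<Gamma> \<theta> \<and>
             ((\<forall>L\<in>Lines \<Gamma>. inc_dist \<Gamma> L (\<theta> L) \<in> {6, 8}) \<or>
              (\<forall>p\<in>Points \<Gamma>. inc_dist \<Gamma> p (\<theta> p) \<in> {6, 8}))) \<and>
        (\<forall>\<theta>. collineation \<Gamma> \<theta> \<and>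
             ((\<forall>L\<in>Lines \<Gamma>. inc_dist \<Gamma> L (\<theta> L) \<in> {4, 6, 8}) \<or>
              (\<forall>p\<in>Points \<Gamma>. inc_dist \<Gamma> p (\<theta> p) \<in> {4, 6, 8})) \<longrightarrow> coprime s t)))"
proof -
  interpret polygon \<Gamma> "2 * n" by unfold_locales (rule assms(2))
  have far: "(\<forall>l\<in>L. d l (\<theta> l) \<ge> m) \<or> (\<forall>p\<in>P. d p (\<theta> p) \<ge> m)"
    if "(\<forall>l\<in>L. d l (\<theta> l) \<in> X) \<or> (\<forall>p\<in>P. d p (\<theta> p) \<in> X)" "\<forall>x\<in>X. x \<ge> m" for m \<theta> X
    using that by blast
  have anisotropic_far: "(\<forall>l\<in>L. d l (\<theta> l) \<ge> m) \<or> (\<forall>p\<in>P. d p (\<theta> p) \<ge> m)"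
    if "collineation \<Gamma> \<theta> \<and> anisotropic n \<Gamma> \<theta>" "m \<le> 2 * n" for m \<theta>
    using anisotropic_collineation_points[of \<theta> n] that by simp
  have part: "(n = 2 \<longrightarrow>
        (\<exists>\<theta>. collineation \<Gamma> \<theta> \<and> anisotropic n \<Gamma> \<theta>) \<longrightarrow> coprime s t) \<and>
      (n = 3 \<longrightarrow>
        (\<nexists>\<theta>. collineation \<Gamma> \<theta> \<and> anisotropic n \<Gamma> \<theta>) \<and>
        (\<forall>\<theta>. collineation \<Gamma> \<theta> \<and>
             ((\<forall>l\<in>L. d l (\<theta> l) \<in> {4, 6}) \<or> (\<forall>p\<in>P. d p (\<theta> p) \<in> {4, 6})) \<longrightarrow> coprime s t)) \<and>
      (n = 4 \<longrightarrow>
        (\<nexists>\<theta>. collineation \<Gamma> \<theta> \<and> anisotropic n \<Gamma> \<theta>) \<and>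
        (\<nexists>\<theta>. collineation \<Gamma> \<theta> \<and>
             ((\<forall>l\<in>L. d l (\<theta> l) \<in> {6, 8}) \<or> (\<forall>p\<in>P. d p (\<theta> p) \<in> {6, 8}))) \<and>
        (\<forall>\<theta>. collineation \<Gamma> \<theta> \<and>
             ((\<forall>l\<in>L. d l (\<theta> l) \<in> {4, 6, 8}) \<or> (\<forall>p\<in>P. d p (\<theta> p) \<in> {4, 6, 8})) \<longrightarrow> coprime s t))"
    if par: "finite E \<and> has_parameters \<Gamma> s t" for s t
  proof -
    note disp = collineation_displacement[OF assms(3) conjunct1[OF par] conjunct2[OF par]]
    show ?thesis
    proof (intro conjI impI allI notI; (elim exE)?)
      fix \<theta> assume n: "n = 2" and \<theta>: "collineation \<Gamma> \<theta> \<and> anisotropic n \<Gamma> \<theta>"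
      show "coprime s t" by (rule disp(1)[OF conjunct1[OF \<theta>] anisotropic_far[OF \<theta>]]) (simp_all add: n)
    next
      fix \<theta> assume n: "n = 3" and \<theta>: "collineation \<Gamma> \<theta> \<and> anisotropic n \<Gamma> \<theta>"
      show False by (rule disp(4)[OF conjunct1[OF \<theta>] anisotropic_far[OF \<theta>]]) (simp_all add: n)
    next
      fix \<theta> assume n: "n = 3" and \<theta>: "collineation \<Gamma> \<theta> \<and>
        ((\<forall>l\<in>L. d l (\<theta> l) \<in> {4, 6}) \<or> (\<forall>p\<in>P. d p (\<theta> p) \<in> {4, 6}))"
      show "coprime s t" by (rule disp(2)[OF conjunct1[OF \<theta>] far[OF conjunct2[OF \<theta>]]]) (simp_all add: n)
    next
      fix \<theta> assume n: "n = 4" and \<theta>: "collineation \<Gamma> \<theta> \<and> anisotropic n \<Gamma> \<theta>"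
      show False by (rule disp(5)[OF conjunct1[OF \<theta>] anisotropic_far[OF \<theta>]]) (simp_all add: n)
    next
      fix \<theta> assume n: "n = 4" and \<theta>: "collineation \<Gamma> \<theta> \<and>
        ((\<forall>l\<in>L. d l (\<theta> l) \<in> {6, 8}) \<or> (\<forall>p\<in>P. d p (\<theta> p) \<in> {6, 8}))"
      show False by (rule disp(5)[OF conjunct1[OF \<theta>] far[OF conjunct2[OF \<theta>]]]) (simp_all add: n)
    next
      fix \<theta> assume n: "n = 4" and \<theta>: "collineation \<Gamma> \<theta> \<and>
        ((\<forall>l\<in>L. d l (\<theta> l) \<in> {4, 6, 8}) \<or> (\<forall>p\<in>P. d p (\<theta> p) \<in> {4, 6, 8}))"
      show "coprime s t" by (rule disp(3)[OF conjunct1[OF \<theta>] far[OF conjunct2[OF \<theta>]]]) (simp_all add: n)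
    qed
  qed
  have "\<nexists>\<theta>. duality \<Gamma> \<theta> \<and> anisotropic n \<Gamma> \<theta>" using no_anisotropic_duality[OF refl] by blast
  thus ?thesis using part by (rule conjI[OF _ allI[OF allI[OF impI]]])
qed

end
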